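(* Let $d\ge2$, let $\Omega\subset\mathbb{R}^d$ be an open set with compact Lipschitz boundary, and let $u\in\mathrm{BV}(\Omega)$. For every $\epsilon>0$ there exists $\delta>0$ such that $|Du|(B)<\epsilon$ whenever $B\subset\Omega$ is a Borel set with $\mathcal{H}^{d-1}(B)<\delta$.
   Context: $\mathrm{BV}(\Omega)$ is the space of integrable functions $u$ on $\Omega$ whose distributional gradient $Du$ is a finite ($\mathbb{R}^d$-valued) Radon measure in $\Omega$; $|Du|$ is its total variation measure. $\mathcal{H}^{d-1}$ is the $(d-1)$-dimensional Hausdorff measure. *)

theory Defs
  imports "HOL-Analysis.Analysis"
begin

subsection \<open>Hausdorff measure\<close>

(* The covering sets must be bounded, since the value of "diameter" is meaningless on unbounded
   sets. Empty sets contribute 0, also for k = 0 (where 0 ^ 0 = 1). The factor unit_ball_vol k is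
   the usual normalisation, making the measure agree with Lebesgue measure on k-planes. *)
definition hausdorff_premeasure :: "nat \<Rightarrow> real \<Rightarrow> 'a::metric_space set \<Rightarrow> ennreal" where
  "hausdorff_premeasure k r B =
     (INF C \<in> {C :: nat \<Rightarrow> 'a set. B \<subseteq> (\<Union>n. C n) \<and> (\<forall>n. bounded (C n) \<and> diameter (C n) \<le> r)}.
        \<Sum>n. if C n = {} then 0 else ennreal (unit_ball_vol (real k) * (diameter (C n) / 2) ^ k))"

definition hausdorff_measure :: "nat \<Rightarrow> 'a::metric_space set \<Rightarrow> ennreal" where
  "hausdorff_measure k B = (SUP r \<in> {0<..}. hausdorff_premeasure k r B)"


subsection \<open>Vector-valued measures\<close>

(* A countably additive set function with values in a Euclidean space has finite total variation;
   on an open subset of a Euclidean space it is moreover regular, so these are precisely the finite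
   vector-valued Radon measures. Taking A constantly empty gives \<mu> {} = 0. The values of \<mu> outside
   the Borel subsets of \<Omega> are irrelevant. *)
definition vector_measure_on ::
    "'a::topological_space set \<Rightarrow> ('a set \<Rightarrow> 'b::euclidean_space) \<Rightarrow> bool" where
  "vector_measure_on \<Omega> \<mu> \<longleftrightarrow>
     (\<forall>A :: nat \<Rightarrow> 'a set. range A \<subseteq> sets (restrict_space borel \<Omega>) \<and> disjoint_family A
        \<longrightarrow> (\<lambda>n. \<mu> (A n)) sums \<mu> (\<Union>n. A n))"

definition total_variation ::
    "('a::topological_space set \<Rightarrow> 'b::euclidean_space) \<Rightarrow> 'a set \<Rightarrow> ennreal" where
  "total_variation \<mu> B =
     (SUP A \<in> {A :: nat \<Rightarrow> 'a set. range A \<subseteq> sets borel \<and> disjoint_family A \<and> (\<Union>n. A n) = B}.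
        \<Sum>n. ennreal (norm (\<mu> (A n))))"

(* Jordan decomposition: the positive and negative part of \<nu> are (|\<nu>| + \<nu>) / 2 and (|\<nu>| - \<nu>) / 2;
   the negative part of \<nu> is the positive part of -\<nu>. *)
definition positive_part :: "'a::topological_space set \<Rightarrow> ('a set \<Rightarrow> real) \<Rightarrow> 'a measure" where
  "positive_part \<Omega> \<nu> =
     measure_of \<Omega> (sets (restrict_space borel \<Omega>))
       (\<lambda>B. ennreal ((enn2real (total_variation \<nu> B) + \<nu> B) / 2))"

definition signed_integral ::
    "'a::topological_space set \<Rightarrow> ('a set \<Rightarrow> real) \<Rightarrow> ('a \<Rightarrow> real) \<Rightarrow> real" where
  "signed_integral \<Omega> \<nu> f =
     integral\<^sup>L (positive_part \<Omega> \<nu>) f - integral\<^sup>L (positive_part \<Omega> (\<lambda>B. - \<nu> B)) f"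


subsection \<open>Test functions\<close>

definition partial_deriv ::
    "'a::euclidean_space \<Rightarrow> ('a \<Rightarrow> real) \<Rightarrow> 'a \<Rightarrow> real" where
  "partial_deriv i f = (\<lambda>x. frechet_derivative f (at x) i)"

definition smooth :: "('a::euclidean_space \<Rightarrow> real) \<Rightarrow> bool" where
  "smooth f \<longleftrightarrow>
     (\<forall>is. set is \<subseteq> Basis \<longrightarrow> (\<forall>x. foldr partial_deriv is f differentiable at x))"

definition test_function :: "'a::euclidean_space set \<Rightarrow> ('a \<Rightarrow> real) \<Rightarrow> bool" where
  "test_function \<Omega> \<phi> \<longleftrightarrow>
     smooth \<phi> \<and> compact (closure {x. \<phi> x \<noteq> 0}) \<and> closure {x. \<phi> x \<noteq> 0} \<subseteq> \<Omega>"


subsection \<open>Functions of bounded variation\<close>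

definition is_distributional_gradient ::
    "'a::euclidean_space set \<Rightarrow> ('a \<Rightarrow> real) \<Rightarrow> ('a set \<Rightarrow> 'a) \<Rightarrow> bool" where
  "is_distributional_gradient \<Omega> u \<mu> \<longleftrightarrow>
     vector_measure_on \<Omega> \<mu> \<and>
     (\<forall>\<phi>. test_function \<Omega> \<phi> \<longrightarrow>
        (\<forall>i\<in>Basis. (LINT x:\<Omega>|lebesgue. u x * partial_deriv i \<phi> x)
                    = - signed_integral \<Omega> (\<lambda>B. \<mu> B \<bullet> i) \<phi>))"

definition BV :: "'a::euclidean_space set \<Rightarrow> ('a \<Rightarrow> real) set" where
  "BV \<Omega> = {u. set_integrable lebesgue \<Omega> u \<and> (\<exists>\<mu>. is_distributional_gradient \<Omega> u \<mu>)}"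

(* For open \<Omega> and u in BV \<Omega> the gradient is determined on all Borel subsets of \<Omega>, because finite
   Radon measures are determined by their integrals of test functions. The choice only concerns
   the irrelevant values on other sets. *)
definition distributional_gradient ::
    "'a::euclidean_space set \<Rightarrow> ('a \<Rightarrow> real) \<Rightarrow> 'a set \<Rightarrow> 'a" where
  "distributional_gradient \<Omega> u = (SOME \<mu>. is_distributional_gradient \<Omega> u \<mu>)"


subsection \<open>Lipschitz boundary\<close>

(* In orthonormal coordinates whose last axis is e, x - (x \<bullet> e) *\<^sub>R e is the vector of the first d - 1
   coordinates of x and x \<bullet> e is the last one: near p, \<Omega> lies strictly above the graph of g. *)
definition lipschitz_boundary :: "'a::euclidean_space set \<Rightarrow> bool" where
  "lipschitz_boundary \<Omega> \<longleftrightarrow>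
     (\<forall>p \<in> frontier \<Omega>. \<exists>e r L. \<exists>g :: 'a \<Rightarrow> real.
        norm e = 1 \<and> r > 0 \<and> L-lipschitz_on {y. y \<bullet> e = 0} g \<and>
        \<Omega> \<inter> ball p r = {x \<in> ball p r. g (x - (x \<bullet> e) *\<^sub>R e) < x \<bullet> e})"

end

(* The epsilon-delta statement follows from |Du|(B) = 0 for every Borel set B with H^(d-1)(B) = 0, by
   passing to the limsup of a sequence of bad sets. By inner regularity and the Hahn decomposition of the
   components nu = D_i u, it suffices that nu(K) = 0 for compact H^(d-1)-null K. Work with difference
   quotients: for a continuous phi with compact support in U and small h > 0, the integral of
   u(x) (phi(x + h e_i) - phi(x)) / h is at most |nu|(U) sup |phi| in absolute value, and this bound is
   inherited by every truncation T(u) of u. If phi = 1 near K and kappa is a cutoff function of a cover of K by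
   finitely many balls with small sum of r^(d-1), then the part with phi - kappa is at most |nu|(U - K),
   while the part with kappa is at most sup |T(u)| times the sum of r^(d-1), hence negligible. Removing
   the truncation in L^1 gives |nu(phi)| <= |nu|(U - K), and letting phi and U shrink to K gives nu(K) = 0.
   This avoids the coarea formula and the structure theory of sets of finite perimeter. *)

theory Submission
  imports Defs
begin

subsection \<open>Signed measures: Hahn decomposition\<close>

text \<open>The obstacle is that \<open>u\<close> may be unbounded. A cutoff for a ball of radius
  rho has increments of size h / rho on a set of volume about rho^d, so against a bounded function
  it costs about h rho^(d-1), but against an unbounded one this cost is out of control. Truncation
  would usually call for a chain rule in BV. For finite differences it is elementary: if T is
  1-Lipschitz, then T(u(x-h)) - T(u(x)) = m(x) (u(x-h) - u(x)) with |m| <= 1. As m is merely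
  measurable, the increment estimate has to hold for all continuous test functions, with a range of
  h that depends only on their support; an estimate for smooth functions with h depending on the
  function would not survive the approximation of m. The order of the limits matters: the cover is
  chosen after the truncation level, then h tends to 0, and only then is the truncation removed. The
  last step is uniform in h because phi is fixed and Lipschitz, whereas kappa has no Lipschitz bound
  independent of the cover.\<close>

lemma vector_measure_on_empty:
  assumes "vector_measure_on \<Omega> \<nu>"
  shows "\<nu> {} = 0"
proof -
  have "(\<lambda>n::nat. \<nu> {}) sums \<nu> {}"
    using assms[unfolded vector_measure_on_def, rule_format, of "\<lambda>_. {}"]
    by (auto simp: disjoint_family_on_def)
  then show ?thesis
    by (metis sums_summable summable_const_iff)
qed

lemma vector_measure_on_Un:
  assumes "vector_measure_on \<Omega> \<nu>" "A \<in> sets (restrict_space borel \<Omega>)"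
    "B \<in> sets (restrict_space borel \<Omega>)" "A \<inter> B = {}"
  shows "\<nu> (A \<union> B) = \<nu> A + \<nu> B"
proof -
  have "(\<lambda>n. \<nu> (binaryset A B n)) sums \<nu> (\<Union>n. binaryset A B n)"
  proof -
    have "range (binaryset A B) \<subseteq> sets (restrict_space borel \<Omega>)"
      using assms(2,3) by (simp add: range_binaryset_eq)
    moreover have "disjoint_family (binaryset A B)"
      using assms(4) by (auto simp: disjoint_family_on_def binaryset_def)
    ultimately show ?thesis
      using assms(1) unfolding vector_measure_on_def by blast
  qed
  moreover have "(\<lambda>n. \<nu> (binaryset A B n)) sums (\<nu> A + \<nu> B)"
    using vector_measure_on_empty[OF assms(1)] by (intro binaryset_sums)
  ultimately show ?thesis
    by (simp add: UN_binaryset_eq sums_unique2)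
qed

lemma vector_measure_on_Diff:
  assumes "vector_measure_on \<Omega> \<nu>" "A \<in> sets (restrict_space borel \<Omega>)"
    "B \<in> sets (restrict_space borel \<Omega>)" "B \<subseteq> A"
  shows "\<nu> (A - B) = \<nu> A - \<nu> B"
  using vector_measure_on_Un[OF assms(1) assms(3), of "A - B"] assms(2-)
  by (simp add: Un_absorb1 sets.Diff)

lemma vector_measure_on_Un_Int:
  assumes "vector_measure_on \<Omega> \<nu>" "A \<in> sets (restrict_space borel \<Omega>)"
    "B \<in> sets (restrict_space borel \<Omega>)"
  shows "\<nu> (A \<union> B) + \<nu> (A \<inter> B) = \<nu> A + \<nu> B"
  using vector_measure_on_Un[OF assms(1,2), of "B - A \<inter> B"]
    vector_measure_on_Diff[OF assms(1,3), of "A \<inter> B"] assms(2-)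
  by (simp add: sets.Diff sets.Int Diff_Int Int_Diff)

lemma vector_measure_on_incseq:
  assumes "vector_measure_on \<Omega> \<nu>" "range A \<subseteq> sets (restrict_space borel \<Omega>)" "incseq A"
  shows "(\<lambda>n. \<nu> (A n)) \<longlonglongrightarrow> \<nu> (\<Union>n. A n)"
proof -
  have d: "range (disjointed A) \<subseteq> sets (restrict_space borel \<Omega>)"
    using sets.range_disjointed_sets[OF assms(2)] .
  have s: "(\<lambda>n. \<nu> (disjointed A n)) sums \<nu> (\<Union>n. A n)"
    using assms(1)[unfolded vector_measure_on_def, rule_format, of "disjointed A"] d
      disjoint_family_disjointed[of A] UN_disjointed_eq[of A] by auto
  have "(\<Sum>i<Suc n. \<nu> (disjointed A i)) = \<nu> (A n)" for n
  proof (induction n)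
    case 0
    then show ?case by simp
  next
    case (Suc n)
    have "disjointed A (Suc n) = A (Suc n) - A n"
      using disjointed_mono[of A n] assms(3) by (auto simp: mono_def)
    moreover have "\<nu> (A (Suc n) - A n) = \<nu> (A (Suc n)) - \<nu> (A n)"
      using assms by (intro vector_measure_on_Diff[OF assms(1)]) (auto simp: incseq_SucD)
    ultimately show ?case using Suc by simp
  qed
  then show ?thesis
    using s[unfolded sums_def, THEN LIMSEQ_Suc] by simp
qed

lemma vector_measure_on_decseq:
  assumes "vector_measure_on \<Omega> \<nu>" "range A \<subseteq> sets (restrict_space borel \<Omega>)" "decseq A"
  shows "(\<lambda>n. \<nu> (A n)) \<longlonglongrightarrow> \<nu> (\<Inter>n. A n)"
proof -
  have I: "(\<Inter>n. A n) \<in> sets (restrict_space borel \<Omega>)"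
    using assms(2) by (intro sets.countable_INT) auto
  have "(\<lambda>n. \<nu> (A 0 - A n)) \<longlonglongrightarrow> \<nu> (\<Union>n. A 0 - A n)"
    using assms by (intro vector_measure_on_incseq[OF assms(1)]) (auto simp: decseq_def incseq_def)
  moreover have "(\<Union>n. A 0 - A n) = A 0 - (\<Inter>n. A n)" by auto
  moreover have "\<nu> (A 0 - A n) = \<nu> (A 0) - \<nu> (A n)" for n
    using assms by (intro vector_measure_on_Diff[OF assms(1)]) (auto simp: decseq_def)
  moreover have "\<nu> (A 0 - (\<Inter>n. A n)) = \<nu> (A 0) - \<nu> (\<Inter>n. A n)"
    using assms I by (intro vector_measure_on_Diff[OF assms(1)]) auto
  ultimately have "(\<lambda>n. \<nu> (A 0) - \<nu> (A n)) \<longlonglongrightarrow> \<nu> (A 0) - \<nu> (\<Inter>n. A n)"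
    by simp
  from tendsto_diff[OF tendsto_const[of "\<nu> (A 0)"] this] show ?thesis by simp
qed

(* If nu is unbounded on the subsets of E, then E splits into a part where it is still unbounded and
   a part of measure at least 1 in absolute value; iterating contradicts countable additivity. *)
lemma vector_measure_on_bounded:
  fixes \<nu> :: "'a::topological_space set \<Rightarrow> 'b::euclidean_space"
  assumes \<nu>: "vector_measure_on \<Omega> \<nu>"
  shows "\<exists>c. \<forall>A\<in>sets (restrict_space borel \<Omega>). norm (\<nu> A) \<le> c"
proof (rule ccontr)
  let ?S = "sets (restrict_space borel \<Omega>)"
  define bad where "bad E \<longleftrightarrow> E \<in> ?S \<and> (\<forall>c. \<exists>A\<in>?S. A \<subseteq> E \<and> norm (\<nu> A) > c)" for E
  assume "\<not> ?thesis"
  then have bad0: "bad \<Omega>"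
    unfolding bad_def by (metis not_le sets.sets_into_space sets.top space_restrict_space
        inf_top_right space_borel)
  have step: "\<exists>E'. bad E' \<and> E' \<subseteq> E \<and> norm (\<nu> (E - E')) \<ge> 1" if E: "bad E" for E
  proof -
    \<comment> \<open>The threshold \<open>norm (\<nu> E) + 1\<close> forces both \<open>A\<close>
      and its complement in \<open>E\<close> to have norm at least 1, so either may be discarded and
      the one on which \<open>\<nu>\<close> is unbounded kept.\<close>
    obtain A where A: "A \<in> ?S" "A \<subseteq> E" "norm (\<nu> A) > norm (\<nu> E) + 1"
      using E unfolding bad_def by blast
    have d: "\<nu> (E - A) = \<nu> E - \<nu> A"
      using A E by (intro vector_measure_on_Diff[OF \<nu>]) (auto simp: bad_def)
    then have n: "norm (\<nu> (E - A)) \<ge> 1" "norm (\<nu> A) \<ge> 1"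
      using A(3) norm_triangle_ineq2[of "\<nu> A" "\<nu> E"] by (auto simp: norm_minus_commute)
         (use norm_ge_zero[of "\<nu> E"] in linarith)
    have EA: "E - A \<in> ?S" using A E by (auto simp: bad_def)
    have EE: "E - (E - A) = A" using A by auto
    show ?thesis
    proof (cases "bad A")
      case True then show ?thesis using n A by blast
    next
      case False
      then obtain c where c: "\<And>B. B \<in> ?S \<Longrightarrow> B \<subseteq> A \<Longrightarrow> norm (\<nu> B) \<le> c"
        using A(1) unfolding bad_def by (meson not_le)
      have "bad (E - A)"
        unfolding bad_def
      proof (intro conjI allI EA)
        fix k
        obtain B where B: "B \<in> ?S" "B \<subseteq> E" "norm (\<nu> B) > c + k"
          using E unfolding bad_def by blast
        have "\<nu> ((B \<inter> A) \<union> (B - A)) = \<nu> (B \<inter> A) + \<nu> (B - A)"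
          using A B by (intro vector_measure_on_Un[OF \<nu>]) auto
        moreover have "(B \<inter> A) \<union> (B - A) = B" by auto
        ultimately have "norm (\<nu> B) \<le> norm (\<nu> (B \<inter> A)) + norm (\<nu> (B - A))"
          by (metis norm_triangle_ineq)
        moreover have "norm (\<nu> (B \<inter> A)) \<le> c" using A B by (intro c) auto
        ultimately have "norm (\<nu> (B - A)) > k" using B(3) by linarith
        then show "\<exists>B\<in>?S. B \<subseteq> E - A \<and> k < norm (\<nu> B)"
          using A B by (intro bexI[of _ "B - A"]) auto
      qed
      then show ?thesis using n(2) EE by (intro exI[of _ "E - A"]) auto
    qed
  qed
  obtain E where E: "\<And>n. bad (E n)" "\<And>n. E (Suc n) \<subseteq> E n \<and> norm (\<nu> (E n - E (Suc n))) \<ge> 1"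
    using dependent_nat_choice[of "\<lambda>_. bad" "\<lambda>_ A B. B \<subseteq> A \<and> norm (\<nu> (A - B)) \<ge> 1"] bad0 step
    by metis
  define D where "D n = E n - E (Suc n)" for n
  have dec: "decseq E" using E(2) by (simp add: decseq_Suc_iff)
  have "D m \<inter> D n = {}" if "m < n" for m n
    using decseqD[OF dec, of "Suc m" n] that by (auto simp: D_def)
  then have "disjoint_family D"
    unfolding disjoint_family_on_def by (metis inf.commute linorder_neqE_nat)
  moreover have "range D \<subseteq> ?S" using E(1) by (auto simp: D_def bad_def)
  ultimately have "(\<lambda>n. \<nu> (D n)) sums \<nu> (\<Union>n. D n)"
    using \<nu> unfolding vector_measure_on_def by blast
  then have "(\<lambda>n. \<nu> (D n)) \<longlonglongrightarrow> 0"
    using sums_summable summable_LIMSEQ_zero by blast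
  then have "(\<lambda>n. norm (\<nu> (D n))) \<longlonglongrightarrow> 0" by (simp add: tendsto_norm_zero)
  moreover have "norm (\<nu> (D n)) \<ge> 1" for n using E(2) by (simp add: D_def)
  ultimately show False using LIMSEQ_le_const[of _ 0 1] by fastforce
qed

(* P is the liminf of a sequence of sets whose measures tend to the supremum fast enough. *)
lemma Hahn_decomposition:
  fixes \<nu> :: "'a::topological_space set \<Rightarrow> real"
  assumes \<nu>: "vector_measure_on \<Omega> \<nu>"
  obtains P where "P \<in> sets (restrict_space borel \<Omega>)"
    "\<And>A. A \<in> sets (restrict_space borel \<Omega>) \<Longrightarrow> \<nu> (A \<inter> P) \<ge> 0"
    "\<And>A. A \<in> sets (restrict_space borel \<Omega>) \<Longrightarrow> \<nu> (A - P) \<le> 0"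
proof -
  let ?S = "sets (restrict_space borel \<Omega>)"
  define s where "s = (SUP A\<in>?S. \<nu> A)"
  obtain c where c: "\<And>A. A \<in> ?S \<Longrightarrow> \<bar>\<nu> A\<bar> \<le> c"
    using vector_measure_on_bounded[OF \<nu>] by auto
  have bdd: "bdd_above (\<nu> ` ?S)" using c by (intro bdd_aboveI[of _ c]) (auto simp: abs_le_iff)
  have le_s: "\<nu> A \<le> s" if "A \<in> ?S" for A
    unfolding s_def using that bdd by (rule cSUP_upper)
  have "\<exists>A\<in>?S. \<nu> A > s - (1/2)^n" for n :: nat
  proof -
    have "s - (1/2)^n < (SUP A\<in>?S. \<nu> A)" unfolding s_def[symmetric] by simp
    then show ?thesis using less_cSUP_iff[OF _ bdd] sets.top by blast
  qed
  then obtain A where A: "\<And>n::nat. A n \<in> ?S" "\<And>n. \<nu> (A n) > s - (1/2)^n"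
    by metis
  define I where "I n m = (\<Inter>k\<in>{n..n+m}. A k)" for n m
  have I: "I n m \<in> ?S" for n m
    unfolding I_def using A(1) by (intro sets.finite_INT) auto
  \<comment> \<open>The deficits of the \<open>A k\<close> with respect to \<open>s\<close> add up
    under intersection, because a union never exceeds \<open>s\<close>. The right-hand side is
    \<open>s\<close> minus the sum of \<open>(1/2)^k\<close> for k from n to n + m.\<close>
  have I_ge: "\<nu> (I n m) \<ge> s - 2 * (1/2)^n + (1/2)^(n+m)" for n m
  proof (induction m)
    case 0
    then show ?case using A(2)[of n] by (simp add: I_def)
  next
    case (Suc m)
    have eq: "I n (Suc m) = I n m \<inter> A (Suc (n+m))"
      by (auto simp: I_def atLeastAtMostSuc_conv)
    have "\<nu> (I n m \<union> A (Suc (n+m))) + \<nu> (I n m \<inter> A (Suc (n+m))) = \<nu> (I n m) + \<nu> (A (Suc (n+m)))"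
      using I A by (intro vector_measure_on_Un_Int[OF \<nu>]) auto
    moreover have "\<nu> (I n m \<union> A (Suc (n+m))) \<le> s" using I A by (intro le_s) auto
    ultimately show ?case using Suc A(2)[of "Suc (n+m)"] unfolding eq by (simp add: power_add)
  qed
  define J where "J n = (\<Inter>m. I n m)" for n
  have J: "J n \<in> ?S" for n
    unfolding J_def using I by (intro sets.countable_INT) auto
  have J_ge: "\<nu> (J n) \<ge> s - 2 * (1/2)^n" for n
  proof (rule LIMSEQ_le_const)
    show "(\<lambda>m. \<nu> (I n m)) \<longlonglongrightarrow> \<nu> (J n)"
      unfolding J_def using I
      by (intro vector_measure_on_decseq[OF \<nu>]) (auto simp: decseq_def I_def)
    have "s - 2 * (1/2)^n \<le> \<nu> (I n m)" for m
      using I_ge[of n m] by (smt (verit) zero_le_power zero_less_divide_1_iff)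
    then show "\<exists>N. \<forall>m\<ge>N. s - 2 * (1/2)^n \<le> \<nu> (I n m)" by blast
  qed
  define P where "P = (\<Union>n. J n)"
  have P: "P \<in> ?S" unfolding P_def using J by auto
  have J_eq: "J n = (\<Inter>k\<in>{n..}. A k)" for n
    unfolding J_def I_def by (auto simp: le_iff_add) fastforce
  have "(\<lambda>n. \<nu> (J n)) \<longlonglongrightarrow> \<nu> P"
    unfolding P_def using J
    by (intro vector_measure_on_incseq[OF \<nu>]) (auto simp: incseq_def J_eq)
  moreover have "(\<lambda>n. s - 2 * (1/2::real)^n) \<longlonglongrightarrow> s - 2 * 0"
    by (intro tendsto_intros LIMSEQ_power_zero) auto
  ultimately have "s \<le> \<nu> P"
    using J_ge by (intro LIMSEQ_le[of "\<lambda>n. s - 2 * (1/2::real)^n" s]) auto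
  then have Ps: "\<nu> P = s" using le_s[OF P] by simp
  show thesis
  proof (rule that[OF P])
    fix B assume B: "B \<in> ?S"
    \<comment> \<open>Since \<open>P\<close> attains the supremum, neither removing a part of
      negative measure nor adding a part of positive measure is possible.\<close>
    have "\<nu> (P - B \<inter> P) = \<nu> P - \<nu> (B \<inter> P)"
      using B P by (intro vector_measure_on_Diff[OF \<nu>]) auto
    moreover have "\<nu> (P - B \<inter> P) \<le> s" using B P by (intro le_s) auto
    ultimately show "\<nu> (B \<inter> P) \<ge> 0" using Ps by simp
    have "\<nu> (P \<union> (B - P)) = \<nu> P + \<nu> (B - P)"
      using B P by (intro vector_measure_on_Un[OF \<nu>]) auto
    moreover have "\<nu> (P \<union> (B - P)) \<le> s" using B P by (intro le_s) auto
    ultimately show "\<nu> (B - P) \<le> 0" using Ps by simp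
  qed
qed

section \<open>Jordan parts of a real-valued measure and integration against them\<close>

lemma vector_measure_on_component:
  assumes "vector_measure_on \<Omega> \<mu>"
  shows "vector_measure_on \<Omega> (\<lambda>B. \<mu> B \<bullet> i)"
  using assms unfolding vector_measure_on_def
  by (auto intro!: bounded_linear.sums[OF bounded_linear_inner_left])

lemma vector_measure_on_uminus:
  assumes "vector_measure_on \<Omega> \<nu>"
  shows "vector_measure_on \<Omega> (\<lambda>B. - \<nu> B)"
  using assms unfolding vector_measure_on_def by (auto intro!: sums_minus)

text \<open>For a Hahn set \<open>P\<close> this is the positive part of \<open>\<nu>\<close>,
  extended by 0 to all Borel sets of the space, so that Borel functions and inner regularity apply
  without restricted spaces. The negative part arises from \<open>- \<nu>\<close> and
  \<open>\<Omega> - P\<close>.\<close>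

definition part_measure ::
    "'a::topological_space set \<Rightarrow> ('a set \<Rightarrow> real) \<Rightarrow> 'a set \<Rightarrow> 'a measure" where
  "part_measure \<Omega> \<nu> P = measure_of UNIV (sets borel) (\<lambda>A. ennreal (\<nu> (A \<inter> P)))"

lemma sets_part_measure [simp, measurable_cong]: "sets (part_measure \<Omega> \<nu> P) = sets borel"
  unfolding part_measure_def using sets.sigma_sets_eq[of borel] by (simp add: sets_measure_of)

lemma space_part_measure [simp]: "space (part_measure \<Omega> \<nu> P) = UNIV"
  unfolding part_measure_def by (simp add: space_measure_of_conv)

lemma emeasure_part_measure:
  fixes \<nu> :: "'a::topological_space set \<Rightarrow> real"
  assumes \<nu>: "vector_measure_on \<Omega> \<nu>" and \<Omega>: "\<Omega> \<in> sets borel"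
    and P: "P \<in> sets borel" "P \<subseteq> \<Omega>"
    and pos: "\<And>A. A \<in> sets borel \<Longrightarrow> \<nu> (A \<inter> P) \<ge> 0" and A: "A \<in> sets borel"
  shows "emeasure (part_measure \<Omega> \<nu> P) A = ennreal (\<nu> (A \<inter> P))"
  unfolding part_measure_def
proof (rule emeasure_measure_of_sigma)
  show "sigma_algebra (UNIV::'a set) (sets borel)"
    using sets.sigma_algebra_axioms[of borel] by simp
  show "positive (sets borel) (\<lambda>A. ennreal (\<nu> (A \<inter> P)))"
    using vector_measure_on_empty[OF \<nu>] by (simp add: positive_def)
  show "countably_additive (sets borel) (\<lambda>A. ennreal (\<nu> (A \<inter> P)))"
    unfolding countably_additive_def
  proof (intro allI impI)
    fix B :: "nat \<Rightarrow> 'a set" assume B: "range B \<subseteq> sets borel" "disjoint_family B"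
    have "range (\<lambda>n. B n \<inter> P) \<subseteq> sets (restrict_space borel \<Omega>)"
      using B(1) P \<Omega> by (auto simp: sets_restrict_space_iff)
    moreover have "disjoint_family (\<lambda>n. B n \<inter> P)"
      using B(2) by (auto simp: disjoint_family_on_def)
    ultimately have "(\<lambda>n. \<nu> (B n \<inter> P)) sums \<nu> (\<Union>n. B n \<inter> P)"
      using \<nu> unfolding vector_measure_on_def by blast
    then show "(\<Sum>n. ennreal (\<nu> (B n \<inter> P))) = ennreal (\<nu> (\<Union> (range B) \<inter> P))"
      using pos B(1) by (intro suminf_ennreal_eq) (auto simp: Int_UN_distrib2)
  qed
qed (rule A)

lemma finite_part_measure:
  fixes \<nu> :: "'a::topological_space set \<Rightarrow> real"
  assumes "vector_measure_on \<Omega> \<nu>" "\<Omega> \<in> sets borel" "P \<in> sets borel" "P \<subseteq> \<Omega>"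
    "\<And>A. A \<in> sets borel \<Longrightarrow> \<nu> (A \<inter> P) \<ge> 0"
  shows "finite_measure (part_measure \<Omega> \<nu> P)"
  using emeasure_part_measure[where \<nu>=\<nu> and P=P, OF assms, of UNIV] by (intro finite_measureI) simp

text \<open>For an arbitrary partition the triangle inequality and the countable additivity of the
  two parts give the upper bound. The partition of \<open>A\<close> into its pieces inside and
  outside \<open>P\<close>, padded with empty sets, attains it.\<close>

lemma total_variation_Hahn:
  fixes \<nu> :: "'a::topological_space set \<Rightarrow> real"
  assumes \<nu>: "vector_measure_on \<Omega> \<nu>" and \<Omega>: "\<Omega> \<in> sets borel"
    and P: "P \<in> sets borel" "P \<subseteq> \<Omega>"
    and pos: "\<And>A. A \<in> sets borel \<Longrightarrow> \<nu> (A \<inter> P) \<ge> 0"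
    and neg: "\<And>A. A \<in> sets borel \<Longrightarrow> \<nu> (A \<inter> (\<Omega> - P)) \<le> 0"
    and A: "A \<in> sets borel" "A \<subseteq> \<Omega>"
  shows "total_variation \<nu> A = ennreal (\<nu> (A \<inter> P)) + ennreal (- \<nu> (A \<inter> (\<Omega> - P)))"
proof (rule antisym)
  let ?mp = "part_measure \<Omega> \<nu> P" and ?mn = "part_measure \<Omega> (\<lambda>A. - \<nu> A) (\<Omega> - P)"
  have mp: "emeasure ?mp B = ennreal (\<nu> (B \<inter> P))" if "B \<in> sets borel" for B
    using assms that by (intro emeasure_part_measure) auto
  have mn: "emeasure ?mn B = ennreal (- \<nu> (B \<inter> (\<Omega> - P)))" if "B \<in> sets borel" for B
    using assms that by (intro emeasure_part_measure vector_measure_on_uminus) auto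
  have split: "\<nu> B = \<nu> (B \<inter> P) + \<nu> (B \<inter> (\<Omega> - P))" if "B \<in> sets borel" "B \<subseteq> \<Omega>" for B
  proof -
    have "\<nu> ((B \<inter> P) \<union> (B \<inter> (\<Omega> - P))) = \<nu> (B \<inter> P) + \<nu> (B \<inter> (\<Omega> - P))"
      using that \<Omega> P by (intro vector_measure_on_Un[OF \<nu>]) (auto simp: sets_restrict_space_iff)
    moreover have "(B \<inter> P) \<union> (B \<inter> (\<Omega> - P)) = B" using that by auto
    ultimately show ?thesis by simp
  qed
  show "total_variation \<nu> A \<le> ennreal (\<nu> (A \<inter> P)) + ennreal (- \<nu> (A \<inter> (\<Omega> - P)))"
    unfolding total_variation_def
  proof (rule SUP_least, clarify)
    fix C :: "nat \<Rightarrow> 'a set"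
    assume C: "range C \<subseteq> sets borel" "disjoint_family C" "A = \<Union> (range C)"
    have "(\<Sum>n. ennreal (norm (\<nu> (C n)))) \<le> (\<Sum>n. emeasure ?mp (C n) + emeasure ?mn (C n))"
    proof (intro suminf_le)
      fix n
      have Cn: "C n \<in> sets borel" "C n \<subseteq> \<Omega>" using C A(2) by auto
      then have "norm (\<nu> (C n)) \<le> \<nu> (C n \<inter> P) + - \<nu> (C n \<inter> (\<Omega> - P))"
        using split[OF Cn] pos[OF Cn(1)] neg[OF Cn(1)] by simp
      then show "ennreal (norm (\<nu> (C n))) \<le> emeasure ?mp (C n) + emeasure ?mn (C n)"
        using mp[OF Cn(1)] mn[OF Cn(1)] pos[OF Cn(1)] neg[OF Cn(1)]
        by (simp flip: ennreal_plus add: ennreal_leI)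
    qed auto
    also have "\<dots> = emeasure ?mp A + emeasure ?mn A"
      using C by (subst suminf_add[symmetric]) (simp_all add: suminf_emeasure)
    finally show "(\<Sum>n. ennreal (norm (\<nu> (C n)))) \<le>
        ennreal (\<nu> (\<Union> (range C) \<inter> P)) + ennreal (- \<nu> (\<Union> (range C) \<inter> (\<Omega> - P)))"
      using mp mn A C(3) by simp
  qed
  let ?C = "binaryset (A \<inter> P) (A \<inter> (\<Omega> - P))"
  have "(\<Sum>n. ennreal (norm (\<nu> (?C n)))) \<le> total_variation \<nu> A"
    unfolding total_variation_def
  proof (rule SUP_upper, clarify, intro conjI)
    show "range ?C \<subseteq> sets borel" using A P \<Omega> by (auto simp: range_binaryset_eq)
    show "disjoint_family ?C" by (auto simp: disjoint_family_on_def binaryset_def)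
    show "\<Union> (range ?C) = A" using A by (auto simp: UN_binaryset_eq)
  qed
  moreover have "(\<Sum>n. ennreal (norm (\<nu> (?C n)))) = ennreal (norm (\<nu> (A \<inter> P))) + ennreal (norm (\<nu> (A \<inter> (\<Omega> - P))))"
    using vector_measure_on_empty[OF \<nu>] by (intro suminf_binaryset_eq) auto
  ultimately show "ennreal (\<nu> (A \<inter> P)) + ennreal (- \<nu> (A \<inter> (\<Omega> - P))) \<le> total_variation \<nu> A"
    using pos[OF A(1)] neg[OF A(1)] by simp
qed

text \<open>By the previous formula half the sum of total variation and \<open>\<nu>\<close>
  collapses to \<open>\<nu> (A \<inter> P)\<close>. In particular the set function in
  \<open>positive_part\<close> is countably additive; otherwise \<open>measure_of\<close> would
  silently yield the zero measure.\<close>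

lemma positive_part_eq:
  fixes \<nu> :: "'a::topological_space set \<Rightarrow> real"
  assumes \<nu>: "vector_measure_on \<Omega> \<nu>" and \<Omega>: "\<Omega> \<in> sets borel"
    and P: "P \<in> sets borel" "P \<subseteq> \<Omega>"
    and pos: "\<And>A. A \<in> sets borel \<Longrightarrow> \<nu> (A \<inter> P) \<ge> 0"
    and neg: "\<And>A. A \<in> sets borel \<Longrightarrow> \<nu> (A \<inter> (\<Omega> - P)) \<le> 0"
  shows "positive_part \<Omega> \<nu> = restrict_space (part_measure \<Omega> \<nu> P) \<Omega>"
proof -
  let ?M = "restrict_space (part_measure \<Omega> \<nu> P) \<Omega>"
  have S: "sets ?M = sets (restrict_space borel \<Omega>)"
    by (intro sets_restrict_space_cong) simp
  have eq: "ennreal ((enn2real (total_variation \<nu> A) + \<nu> A) / 2) = emeasure ?M A"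
    if "A \<in> sets (restrict_space borel \<Omega>)" for A
  proof -
    have A: "A \<in> sets borel" "A \<subseteq> \<Omega>" using that \<Omega> by (auto simp: sets_restrict_space_iff)
    have tv: "total_variation \<nu> A = ennreal (\<nu> (A \<inter> P)) + ennreal (- \<nu> (A \<inter> (\<Omega> - P)))"
      by (rule total_variation_Hahn[OF \<nu> \<Omega> P]) (fact pos neg A)+
    have "\<nu> ((A \<inter> P) \<union> (A \<inter> (\<Omega> - P))) = \<nu> (A \<inter> P) + \<nu> (A \<inter> (\<Omega> - P))"
      using A \<Omega> P by (intro vector_measure_on_Un[OF \<nu>]) (auto simp: sets_restrict_space_iff)
    moreover have "(A \<inter> P) \<union> (A \<inter> (\<Omega> - P)) = A" using A by auto
    moreover have "enn2real (total_variation \<nu> A) = \<nu> (A \<inter> P) + - \<nu> (A \<inter> (\<Omega> - P))"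
      unfolding tv using pos[OF A(1)] neg[OF A(1)]
      by (subst enn2real_plus) (simp_all only: enn2real_ennreal ennreal_less_top neg_0_le_iff_le)
    ultimately have "(enn2real (total_variation \<nu> A) + \<nu> A) / 2 = \<nu> (A \<inter> P)" by simp
    moreover have "emeasure ?M A = emeasure (part_measure \<Omega> \<nu> P) A"
      using A \<Omega> by (intro emeasure_restrict_space) auto
    moreover have "emeasure (part_measure \<Omega> \<nu> P) A = ennreal (\<nu> (A \<inter> P))"
      by (rule emeasure_part_measure[OF \<nu> \<Omega> P]) (fact pos A)+
    ultimately show ?thesis by metis
  qed
  have sp: "space (restrict_space borel \<Omega>) = \<Omega>" by (simp add: space_restrict_space)
  have "positive_part \<Omega> \<nu> = measure_of \<Omega> (sets (restrict_space borel \<Omega>)) (emeasure ?M)"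
    unfolding positive_part_def
  proof (rule measure_of_eq)
    show "sets (restrict_space borel \<Omega>) \<subseteq> Pow \<Omega>"
      using sets.space_closed[of "restrict_space borel \<Omega>"] unfolding sp .
    show "ennreal ((enn2real (total_variation \<nu> A) + \<nu> A) / 2) = emeasure ?M A"
      if "A \<in> sigma_sets \<Omega> (sets (restrict_space borel \<Omega>))" for A
      using that sets.sigma_sets_eq[of "restrict_space borel \<Omega>"] unfolding sp by (intro eq) simp
  qed
  also have "\<dots> = ?M"
    using measure_of_of_measure[of ?M] S by (simp add: space_restrict_space)
  finally show ?thesis .
qed

lemma signed_integral_eq:
  fixes \<nu> :: "'a::topological_space set \<Rightarrow> real"
  assumes \<nu>: "vector_measure_on \<Omega> \<nu>" and \<Omega>: "\<Omega> \<in> sets borel"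
    and P: "P \<in> sets borel" "P \<subseteq> \<Omega>"
    and pos: "\<And>A. A \<in> sets borel \<Longrightarrow> \<nu> (A \<inter> P) \<ge> 0"
    and neg: "\<And>A. A \<in> sets borel \<Longrightarrow> \<nu> (A \<inter> (\<Omega> - P)) \<le> 0"
    and f: "\<And>x. x \<notin> \<Omega> \<Longrightarrow> f x = 0"
  shows "signed_integral \<Omega> \<nu> f = integral\<^sup>L (part_measure \<Omega> \<nu> P) f
           - integral\<^sup>L (part_measure \<Omega> (\<lambda>A. - \<nu> A) (\<Omega> - P)) f"
proof -
  have "positive_part \<Omega> \<nu> = restrict_space (part_measure \<Omega> \<nu> P) \<Omega>"
    using assms by (intro positive_part_eq) auto
  moreover have "\<Omega> - (\<Omega> - P) = P" using P by auto
  then have "positive_part \<Omega> (\<lambda>A. - \<nu> A) = restrict_space (part_measure \<Omega> (\<lambda>A. - \<nu> A) (\<Omega> - P)) \<Omega>"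
    using assms by (intro positive_part_eq vector_measure_on_uminus) auto
  moreover have "(\<lambda>x. indicator \<Omega> x *\<^sub>R f x) = f"
  proof
    show "indicator \<Omega> x *\<^sub>R f x = f x" for x by (cases "x \<in> \<Omega>") (simp_all add: f)
  qed
  ultimately show ?thesis
    unfolding signed_integral_def using \<Omega> by (simp add: integral_restrict_space)
qed

subsection \<open>Smooth functions of compact support\<close>

text \<open>The classical flat function exp(-1/t), with negative powers of t built in so that the
  linear span of the family is closed under differentiation.\<close>

definition flat_exp :: "nat \<Rightarrow> real \<Rightarrow> real" where
  "flat_exp m t = (if t \<le> 0 then 0 else exp (- 1 / t) / t ^ m)"

lemma flat_exp_tendsto_0: "(flat_exp m \<longlongrightarrow> 0) (at_right 0)"
proof -
  have "((\<lambda>t::real. inverse t ^ m / exp (inverse t)) \<longlongrightarrow> 0) (at_right 0)"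
    using filterlim_compose[OF tendsto_power_div_exp_0 filterlim_inverse_at_top_right] .
  moreover have "eventually (\<lambda>t::real. inverse t ^ m / exp (inverse t) = flat_exp m t) (at_right 0)"
    by (intro eventually_at_rightI[of 0 1])
       (auto simp: flat_exp_def exp_minus field_simps)
  ultimately show ?thesis by (rule Lim_transform_eventually)
qed

lemma DERIV_flat_exp:
  "DERIV (flat_exp m) t :> flat_exp (m + 2) t - real m * flat_exp (m + 1) t"
proof -
  consider "t < 0" | "t = 0" | "t > 0" by linarith
  then show ?thesis
  proof cases
    case 1
    have "((\<lambda>_. 0) has_real_derivative 0) (at t)" by simp
    then have "(flat_exp m has_real_derivative 0) (at t)"
      by (rule has_field_derivative_transform_within_open[where S="{..<0}"])
         (use 1 in \<open>auto simp: flat_exp_def\<close>)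
    then show ?thesis using 1 by (simp add: flat_exp_def)
  next
    case 2
    \<comment> \<open>To the right of 0 the difference quotient of order m is the function of order
      m + 1, so flatness of the whole family gives the derivative at 0.\<close>
    have "((\<lambda>h. flat_exp m h / h) \<longlongrightarrow> 0) (at_right 0)"
    proof (rule Lim_transform_eventually[OF flat_exp_tendsto_0[of "Suc m"]])
      show "\<forall>\<^sub>F h in at_right 0. flat_exp (Suc m) h = flat_exp m h / h"
        by (intro eventually_at_rightI[of 0 1]) (auto simp: flat_exp_def field_simps)
    qed
    moreover have "((\<lambda>h. flat_exp m h / h) \<longlongrightarrow> 0) (at_left 0)"
      by (rule tendsto_eventually)
         (auto intro!: eventually_at_leftI[of "-1"] simp: flat_exp_def)
    ultimately have "((\<lambda>h. flat_exp m h / h) \<longlongrightarrow> 0) (at 0)"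
      by (simp add: filterlim_split_at)
    then show ?thesis using 2 by (simp add: DERIV_def flat_exp_def)
  next
    case 3
    have "((\<lambda>t. exp (- 1 / t) / t ^ m) has_real_derivative
        flat_exp (m + 2) t - real m * flat_exp (m + 1) t) (at t)"
      using 3 by (auto intro!: derivative_eq_intros simp: flat_exp_def field_simps power2_eq_square)
         (cases m; simp add: field_simps)
    then show ?thesis
      by (rule has_field_derivative_transform_within_open[where S="{0<..}"])
         (use 3 in \<open>auto simp: flat_exp_def\<close>)
  qed
qed

(* An algebra of smooth functions that is closed under partial derivatives and translations and
   contains both the polynomials and a nonnegative bump function for every ball. *)
inductive bump_algebra :: "('a::euclidean_space \<Rightarrow> real) \<Rightarrow> bool" where
  const: "bump_algebra (\<lambda>x. c)"
| coord: "bump_algebra (\<lambda>x. x \<bullet> b)"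
| bump: "bump_algebra (\<lambda>x. flat_exp m (r - (x - a) \<bullet> (x - a)))"
| add: "bump_algebra f \<Longrightarrow> bump_algebra g \<Longrightarrow> bump_algebra (\<lambda>x. f x + g x)"
| mult: "bump_algebra f \<Longrightarrow> bump_algebra g \<Longrightarrow> bump_algebra (\<lambda>x. f x * g x)"

lemma bump_algebra_sum:
  assumes "finite I" "\<And>i. i \<in> I \<Longrightarrow> bump_algebra (f i)"
  shows "bump_algebra (\<lambda>x. \<Sum>i\<in>I. f i x)"
  using assms by (induction I rule: finite_induct) (auto intro: bump_algebra.intros)

lemma bump_algebra_diff:
  assumes "bump_algebra f" "bump_algebra g"
  shows "bump_algebra (\<lambda>x. f x - g x)"
  using add[OF assms(1) mult[OF const[of "-1"] assms(2)]] by simp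

lemma bump_algebra_shift:
  assumes "bump_algebra f"
  shows "bump_algebra (\<lambda>x. f (x + c))"
  using assms
proof induction
  case (coord b)
  then show ?case
    using add[OF bump_algebra.coord[of b] const[of "c \<bullet> b"]] by (simp add: inner_left_distrib)
next
  case (bump m r a)
  then show ?case using bump_algebra.bump[of m r "a - c"] by (simp add: algebra_simps)
qed (auto intro: bump_algebra.intros)

text \<open>The derivative of \<open>flat_exp m\<close> is a combination of members of the same
  family, and the inner derivative of the squared distance is affine in \<open>x\<close>; hence
  directional derivatives stay in the algebra. Iterating this gives smoothness.\<close>

lemma bump_algebra_has_derivative:
  assumes "bump_algebra f"
  obtains f' where "\<And>x. (f has_derivative f' x) (at x)" "\<And>v. bump_algebra (\<lambda>x. f' x v)"
proof -
  have "\<exists>f'. (\<forall>x. (f has_derivative f' x) (at x)) \<and> (\<forall>v. bump_algebra (\<lambda>x. f' x v))"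
    using assms
  proof induction
    case (const c)
    then show ?case by (intro exI[of _ "\<lambda>x v. 0"]) (auto intro: bump_algebra.const)
  next
    case (coord b)
    then show ?case
      by (intro exI[of _ "\<lambda>x v. v \<bullet> b"])
         (auto intro!: bump_algebra.const derivative_eq_intros)
  next
    case (bump m r a)
    let ?q = "\<lambda>x. r - (x - a) \<bullet> (x - a)"
    let ?d = "\<lambda>x v. (flat_exp (m + 2) (?q x) - real m * flat_exp (m + 1) (?q x)) * (-2 * ((x - a) \<bullet> v))"
    have "((\<lambda>x. flat_exp m (?q x)) has_derivative ?d x) (at x)" for x
    proof -
      have "(?q has_derivative (\<lambda>v. -2 * ((x - a) \<bullet> v))) (at x)"
        by (auto intro!: derivative_eq_intros simp: inner_commute)
      from has_derivative_compose[OF this DERIV_flat_exp[of m "?q x", unfolded has_field_derivative_def]]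
      show ?thesis by simp
    qed
    moreover have "bump_algebra (\<lambda>x. ?d x v)" for v
      using coord[of v]
      by (intro bump_algebra_diff mult const bump_algebra.bump)
         (simp add: inner_diff_left bump_algebra_diff const)
    ultimately show ?case by (intro exI[of _ ?d] conjI allI)
  next
    case (add f g)
    then obtain f' g' where "\<And>x. (f has_derivative f' x) (at x)" "\<And>v. bump_algebra (\<lambda>x. f' x v)"
      "\<And>x. (g has_derivative g' x) (at x)" "\<And>v. bump_algebra (\<lambda>x. g' x v)" by blast
    then show ?case
      by (intro exI[of _ "\<lambda>x v. f' x v + g' x v"]) (auto intro: bump_algebra.add has_derivative_add)
  next
    case (mult f g)
    then obtain f' g' where "\<And>x. (f has_derivative f' x) (at x)" "\<And>v. bump_algebra (\<lambda>x. f' x v)"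
      "\<And>x. (g has_derivative g' x) (at x)" "\<And>v. bump_algebra (\<lambda>x. g' x v)" by blast
    with mult(1,2) show ?case
      by (intro exI[of _ "\<lambda>x v. f x * g' x v + f' x v * g x"])
         (auto intro!: bump_algebra.add bump_algebra.mult has_derivative_mult)
  qed
  then show ?thesis using that by blast
qed

lemma bump_algebra_partial_deriv:
  assumes "bump_algebra f"
  shows "bump_algebra (partial_deriv i f)"
proof -
  obtain f' where f': "\<And>x. (f has_derivative f' x) (at x)" "\<And>v. bump_algebra (\<lambda>x. f' x v)"
    using bump_algebra_has_derivative[OF assms] by blast
  have "partial_deriv i f = (\<lambda>x. f' x i)"
    unfolding partial_deriv_def using frechet_derivative_at[OF f'(1)] by metis
  then show ?thesis using f'(2) by simp
qed

lemma bump_algebra_differentiable: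
  assumes "bump_algebra f"
  shows "f differentiable at x"
  using bump_algebra_has_derivative[OF assms] differentiableI by metis

lemma bump_algebra_continuous:
  assumes "bump_algebra f"
  shows "continuous_on A f"
  using bump_algebra_differentiable[OF assms]
  by (intro continuous_at_imp_continuous_on) (auto intro: differentiable_imp_continuous_within)

lemma bump_algebra_smooth:
  assumes "bump_algebra f"
  shows "smooth f"
  unfolding smooth_def
proof (intro allI impI)
  fix "is" :: "'a list" and x
  have "bump_algebra (foldr partial_deriv is f)"
    by (induction "is") (auto intro: bump_algebra_partial_deriv assms)
  then show "foldr partial_deriv is f differentiable at x"
    by (rule bump_algebra_differentiable)
qed

lemma bump_algebra_line_deriv:
  assumes "bump_algebra f"
  shows "((\<lambda>t. f (x + t *\<^sub>R e)) has_real_derivative partial_deriv e f (x + s *\<^sub>R e)) (at s)"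
proof -
  have "(f has_derivative frechet_derivative f (at (x + s *\<^sub>R e))) (at (x + s *\<^sub>R e))"
    using bump_algebra_differentiable[OF assms] frechet_derivative_works by blast
  moreover have "((\<lambda>t. x + t *\<^sub>R e) has_derivative (\<lambda>t. t *\<^sub>R e)) (at s)"
    by (auto intro!: derivative_eq_intros)
  ultimately have "((\<lambda>t. f (x + t *\<^sub>R e)) has_derivative
      (\<lambda>t. frechet_derivative f (at (x + s *\<^sub>R e)) (t *\<^sub>R e))) (at s)"
    by (rule has_derivative_compose[rotated])
  moreover have "frechet_derivative f (at (x + s *\<^sub>R e)) (t *\<^sub>R e) = partial_deriv e f (x + s *\<^sub>R e) * t" for t
    using linear_frechet_derivative[OF bump_algebra_differentiable[OF assms]]
    by (simp add: partial_deriv_def linear_cmul)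
  ultimately show ?thesis by (simp add: has_field_derivative_def)
qed

lemma bump_algebra_real_polynomial_function:
  assumes "real_polynomial_function g"
  shows "bump_algebra g"
  using assms
proof induction
  case (linear f)
  then interpret bounded_linear f .
  have "f x = (\<Sum>b\<in>Basis. (x \<bullet> b) * f b)" for x
    by (subst euclidean_representation[of x, symmetric]) (simp add: sum scaleR)
  then have "f = (\<lambda>x. \<Sum>b\<in>Basis. (x \<bullet> b) * f b)" by blast
  moreover have "bump_algebra (\<lambda>x. \<Sum>b\<in>Basis. (x \<bullet> b) * f b)"
    by (intro bump_algebra_sum mult coord const) auto
  ultimately show ?case by metis
qed (auto intro: bump_algebra.intros)

text \<open>Approximation without mollifiers: a sum \<open>\<zeta>\<close> of bumps is positive near
  \<open>L\<close>, the quotient of \<open>\<psi>\<close> by \<open>\<zeta>\<close> is approximated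
  by a polynomial on \<open>L'\<close>, and multiplying back by \<open>\<zeta>\<close> cuts off the
  support. \<open>L'\<close> is chosen before \<open>\<psi>\<close> and \<open>\<epsilon>\<close>,
  so that ranges of step sizes derived from it are uniform.\<close>

lemma bump_algebra_dense:
  fixes L W :: "'a::euclidean_space set"
  assumes L: "compact L" "L \<subseteq> W" and W: "open W"
  obtains L' where "compact L'" "L' \<subseteq> W" "L \<subseteq> L'"
    "\<And>\<psi> \<epsilon>. continuous_on UNIV \<psi> \<Longrightarrow> (\<And>x. x \<notin> L \<Longrightarrow> \<psi> x = 0) \<Longrightarrow> \<epsilon> > 0 \<Longrightarrow>
       \<exists>f. bump_algebra f \<and> (\<forall>x. x \<notin> L' \<longrightarrow> f x = 0) \<and> (\<forall>x. \<bar>f x - \<psi> x\<bar> \<le> \<epsilon>)"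
proof -
  have "\<exists>r>0. cball x r \<subseteq> W" if "x \<in> L" for x
    using that L(2) W open_contains_cball by blast
  then obtain r where r: "\<And>x. x \<in> L \<Longrightarrow> r x > 0 \<and> cball x (r x) \<subseteq> W" by metis
  have "L \<subseteq> (\<Union>x\<in>L. ball x (r x))" using r by force
  with L(1) obtain F where F: "F \<subseteq> L" "finite F" "L \<subseteq> (\<Union>x\<in>F. ball x (r x))"
    using compactE_image[of L L "\<lambda>x. ball x (r x)"] by auto
  define L' where "L' = (\<Union>x\<in>F. cball x (r x))"
  define U where "U = (\<Union>x\<in>F. ball x (r x))"
  define b where "b a x = flat_exp 0 ((r a)\<^sup>2 - (x - a) \<bullet> (x - a))" for a x
  define \<zeta> where "\<zeta> x = (\<Sum>a\<in>F. b a x)" for x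
  have b0: "b a x = 0" if "x \<notin> ball a (r a)" "a \<in> F" for a x
  proof -
    have "r a \<le> norm (x - a)" using that by (simp add: dist_norm norm_minus_commute)
    then have "(r a)\<^sup>2 \<le> (norm (x - a))\<^sup>2" using r[of a] F that by (intro power_mono) auto
    then show ?thesis by (simp add: b_def flat_exp_def dot_square_norm)
  qed
  have bpos: "b a x > 0" if "x \<in> ball a (r a)" "a \<in> F" for a x
  proof -
    have "norm (x - a) < r a" using that by (simp add: dist_norm norm_minus_commute)
    then have "(norm (x - a))\<^sup>2 < (r a)\<^sup>2" by (intro power_strict_mono) auto
    then show ?thesis by (simp add: b_def flat_exp_def dot_square_norm)
  qed
  have b_ge: "b a x \<ge> 0" for a x by (simp add: b_def flat_exp_def)
  have b_le: "b a x \<le> 1" for a x by (simp add: b_def flat_exp_def)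
  have \<zeta>_pos: "\<zeta> x > 0" if "x \<in> U" for x
    using that bpos b_ge F(2) unfolding U_def \<zeta>_def by (auto intro: sum_pos2)
  have \<zeta>_le: "0 \<le> \<zeta> x" "\<zeta> x \<le> real (card F)" for x
    unfolding \<zeta>_def using b_ge b_le sum_bounded_above[of F "\<lambda>a. b a x" 1] by (auto intro: sum_nonneg)
  have \<zeta>0: "\<zeta> x = 0" if "x \<notin> U" for x
    using that b0 unfolding U_def \<zeta>_def by (auto intro!: sum.neutral)
  have \<zeta>_alg: "bump_algebra \<zeta>"
    unfolding \<zeta>_def[abs_def] b_def using F(2) by (intro bump_algebra_sum bump)
  have UL': "U \<subseteq> L'" unfolding U_def L'_def by force
  have opU: "open U" unfolding U_def by auto
  show thesis
  proof (rule that[of L'])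
    show "compact L'" unfolding L'_def using F(2) by auto
    show "L' \<subseteq> W" unfolding L'_def using r F(1) by auto
    show "L \<subseteq> L'" using F(3) UL' by (auto simp: U_def)
    fix \<psi> :: "'a \<Rightarrow> real" and \<epsilon> :: real
    assume \<psi>: "continuous_on UNIV \<psi>" "\<And>x. x \<notin> L \<Longrightarrow> \<psi> x = 0" and \<epsilon>: "\<epsilon> > 0"
    \<comment> \<open>Continuity is checked on the two open sets \<open>U\<close> and
      \<open>- L\<close>, which cover the space: on the first the denominator is positive, on the
      second the numerator is 0.\<close>
    define q where "q x = \<psi> x / \<zeta> x" for x
    have "continuous_on U q"
      unfolding q_def using \<zeta>_pos by (intro continuous_on_divide bump_algebra_continuous \<zeta>_alg
        continuous_on_subset[OF \<psi>(1)]) force+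
    moreover have "continuous_on (- L) q"
      by (rule continuous_on_eq[of _ "\<lambda>_. 0"]) (auto simp: q_def \<psi>)
    ultimately have "continuous_on (U \<union> - L) q"
      using opU L(1) by (intro continuous_on_open_Un) (auto intro: compact_imp_closed)
    moreover have "U \<union> - L = UNIV" using F(3) by (auto simp: U_def)
    ultimately have q: "continuous_on UNIV q" by simp
    \<comment> \<open>Multiplication by \<open>\<zeta>\<close>, which is at most
      \<open>card F\<close>, turns this tolerance into \<open>\<epsilon>\<close>; the summand 1
      keeps the denominator positive when \<open>F\<close> is empty.\<close>
    have "0 < \<epsilon> / (real (card F) + 1)" using \<epsilon> by simp
    then obtain g where g: "real_polynomial_function g"
      "\<And>x. x \<in> L' \<Longrightarrow> \<bar>q x - g x\<bar> < \<epsilon> / (real (card F) + 1)"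
      using Stone_Weierstrass_real_polynomial_function[OF \<open>compact L'\<close> continuous_on_subset[OF q]]
      by (metis top_greatest)
    show "\<exists>f. bump_algebra f \<and> (\<forall>x. x \<notin> L' \<longrightarrow> f x = 0) \<and> (\<forall>x. \<bar>f x - \<psi> x\<bar> \<le> \<epsilon>)"
    proof (intro exI[of _ "\<lambda>x. \<zeta> x * g x"] conjI allI impI)
      show "bump_algebra (\<lambda>x. \<zeta> x * g x)"
        using \<zeta>_alg bump_algebra_real_polynomial_function[OF g(1)] by (rule mult)
      show "\<zeta> x * g x = 0" if "x \<notin> L'" for x using that UL' \<zeta>0 by auto
      fix x
      show "\<bar>\<zeta> x * g x - \<psi> x\<bar> \<le> \<epsilon>"
      proof (cases "x \<in> U")
        case True
        then have "\<psi> x = \<zeta> x * q x" using \<zeta>_pos by (force simp: q_def)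
        then have "\<bar>\<zeta> x * g x - \<psi> x\<bar> = \<zeta> x * \<bar>q x - g x\<bar>"
          using \<zeta>_le(1)[of x] by (simp add: abs_mult abs_minus_commute flip: right_diff_distrib)
        also have "\<dots> \<le> (real (card F) + 1) * (\<epsilon> / (real (card F) + 1))"
          using \<zeta>_le[of x] g(2)[of x] True UL' by (intro mult_mono) force+
        also have "\<dots> = \<epsilon>" by simp
        finally show ?thesis .
      next
        case False
        then have "x \<notin> L" using F(3) by (auto simp: U_def)
        then have "\<psi> x = 0" by (rule \<psi>(2))
        then show ?thesis using \<zeta>0[OF False] \<epsilon> by simp
      qed
    qed
  qed
qed

subsection \<open>Difference quotients of functions of bounded variation\<close>

lemma partial_deriv_shift:
  assumes "bump_algebra f"
  shows "partial_deriv e (\<lambda>x. f (x + c)) x = partial_deriv e f (x + c)"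
proof -
  have "(f has_derivative frechet_derivative f (at (x + c))) (at (x + c))"
    using bump_algebra_differentiable[OF assms] frechet_derivative_works by blast
  moreover have "((\<lambda>x. x + c) has_derivative (\<lambda>v. v)) (at x)"
    by (auto intro!: derivative_eq_intros)
  ultimately have "((\<lambda>x. f (x + c)) has_derivative frechet_derivative f (at (x + c))) (at x)"
    using has_derivative_compose by fastforce
  then show ?thesis
    unfolding partial_deriv_def using frechet_derivative_at by metis
qed

lemma partial_deriv_eq_0:
  assumes "bump_algebra f" "closed L" "\<And>x. x \<notin> L \<Longrightarrow> f x = 0" "x \<notin> L"
  shows "partial_deriv e f x = 0"
proof -
  have "frechet_derivative f (at x) = frechet_derivative (\<lambda>_. 0) (at x)"
    by (rule frechet_derivative_transform_within_open[of _ _ "- L"])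
       (use assms bump_algebra_differentiable in auto)
  then show ?thesis by (simp add: partial_deriv_def)
qed

section \<open>Elementary bounds and translations of Lebesgue integrals\<close>

lemma bounded_if_compact_support:
  fixes f :: "'a::topological_space \<Rightarrow> real"
  assumes "compact L" "continuous_on UNIV f" "\<And>x. x \<notin> L \<Longrightarrow> f x = 0"
  obtains C where "C > 0" "\<And>x. \<bar>f x\<bar> \<le> C"
proof -
  have "bounded (f ` L)"
    using assms(1,2) by (intro compact_imp_bounded compact_continuous_image continuous_on_subset[OF assms(2)]) auto
  then obtain C where C: "C > 0" "\<And>x. x \<in> L \<Longrightarrow> \<bar>f x\<bar> \<le> C"
    unfolding bounded_pos by auto
  have "\<bar>f x\<bar> \<le> C" for x using C assms(3)[of x] by (cases "x \<in> L") auto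
  then show thesis using C(1) that by blast
qed

lemma le_add_small_multiple:
  fixes a b k :: real
  assumes "\<And>\<epsilon>. \<epsilon> > 0 \<Longrightarrow> a \<le> b + \<epsilon> * k"
  shows "a \<le> b"
proof (rule LIMSEQ_le_const)
  show "(\<lambda>n. b + inverse (real (Suc n)) * k) \<longlonglongrightarrow> b"
    using tendsto_add[OF tendsto_const tendsto_mult_left_zero[OF LIMSEQ_inverse_real_of_nat]] by simp
  show "\<exists>N. \<forall>n\<ge>N. a \<le> b + inverse (real (Suc n)) * k"
    using assms by auto
qed

lemma abs_diff_le_double:
  fixes a b :: real
  assumes "\<bar>a\<bar> \<le> c" "\<bar>b\<bar> \<le> c"
  shows "\<bar>a - b\<bar> \<le> 2 * c"
  using assms by linarith

lemma lborel_integral_shift: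
  fixes f :: "'a::euclidean_space \<Rightarrow> real"
  assumes "f \<in> borel_measurable borel"
  shows "(LINT x|lborel. f (x + c)) = (LINT x|lborel. f x)"
proof -
  have "(LINT x|lborel. f x) = integral\<^sup>L (distr lborel borel ((+) c)) f"
    by (simp add: lborel_distr_plus)
  also have "\<dots> = (LINT x|lborel. f (c + x))"
    using assms by (intro integral_distr) auto
  finally show ?thesis by (simp add: add.commute)
qed

lemma lborel_integrable_shift:
  fixes f :: "'a::euclidean_space \<Rightarrow> real"
  assumes "integrable lborel f"
  shows "integrable lborel (\<lambda>x. f (x + c))"
proof -
  have "integrable (distr lborel borel ((+) c)) f"
    using assms by (simp add: lborel_distr_plus)
  then show ?thesis using assms by (subst (asm) integrable_distr_eq) (auto simp: add.commute)
qed

lemma integrable_mult_bounded: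
  fixes f g :: "'a \<Rightarrow> real"
  assumes "integrable M f" "g \<in> borel_measurable M" "\<And>x. \<bar>g x\<bar> \<le> C"
  shows "integrable M (\<lambda>x. f x * g x)"
proof (rule Bochner_Integration.integrable_bound[of M "\<lambda>x. C * \<bar>f x\<bar>"])
  show "AE x in M. norm (f x * g x) \<le> norm (C * \<bar>f x\<bar>)"
    using assms(3) by (intro AE_I2) (simp add: abs_mult mult.commute[of C] mult_left_mono order.trans[OF assms(3) abs_ge_self])
qed (use assms in auto)

lemma integral_mult_bounded_le:
  fixes f g :: "'a \<Rightarrow> real"
  assumes "integrable M f" "g \<in> borel_measurable M" "\<And>x. \<bar>g x\<bar> \<le> C"
  shows "\<bar>\<integral>x. f x * g x \<partial>M\<bar> \<le> C * (\<integral>x. \<bar>f x\<bar> \<partial>M)"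
proof -
  have "\<bar>\<integral>x. f x * g x \<partial>M\<bar> \<le> (\<integral>x. \<bar>f x * g x\<bar> \<partial>M)" by (rule integral_abs_bound)
  also have "\<dots> \<le> (\<integral>x. C * \<bar>f x\<bar> \<partial>M)"
  proof (intro integral_mono)
    show "integrable M (\<lambda>x. \<bar>f x * g x\<bar>)"
      using integrable_mult_bounded[OF assms] by (rule integrable_abs)
    show "\<bar>f x * g x\<bar> \<le> C * \<bar>f x\<bar>" for x
      using mult_left_mono[OF assms(3), of "\<bar>f x\<bar>" x] by (simp add: abs_mult mult.commute)
  qed (use assms(1) in auto)
  finally show ?thesis by simp
qed

text \<open>Integration by parts for finite differences: translation invariance moves the increment
  from \<open>\<phi>\<close> to \<open>v\<close> and reverses the step.\<close>

lemma lborel_integral_increment: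
  fixes v \<phi> :: "'a::euclidean_space \<Rightarrow> real"
  assumes v: "integrable lborel v" and \<phi>: "\<phi> \<in> borel_measurable borel" "\<And>x. \<bar>\<phi> x\<bar> \<le> C"
  shows "(LINT x|lborel. v x * (\<phi> (x + c) - \<phi> x)) = (LINT x|lborel. (v (x - c) - v x) * \<phi> x)"
proof -
  have [measurable]: "v \<in> borel_measurable borel" "\<phi> \<in> borel_measurable borel"
    using v \<phi> by auto
  have v': "integrable lborel (\<lambda>x. v (x - c))" using lborel_integrable_shift[OF v, of "- c"] by simp
  have i: "integrable lborel (\<lambda>x. v x * \<phi> x)" "integrable lborel (\<lambda>x. v x * \<phi> (x + c))"
    "integrable lborel (\<lambda>x. v (x - c) * \<phi> x)"
    using v v' \<phi>(2) by (auto intro!: integrable_mult_bounded[where C=C])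
  have "(LINT x|lborel. v (x - c) * \<phi> x) = (LINT x|lborel. v (x + c - c) * \<phi> (x + c))"
    by (rule lborel_integral_shift[symmetric]) measurable
  then show ?thesis using i by (simp add: algebra_simps)
qed

text \<open>One partial derivative in isolation. In the application \<open>w\<close> is a Borel
  representative of \<open>u\<close> extended by 0, and \<open>M\<close> and \<open>N\<close> are
  the positive and negative part of the derivative in direction \<open>e\<close>.\<close>

locale line_derivative_measure =
  fixes w :: "'a::euclidean_space \<Rightarrow> real" and e :: 'a and \<Omega> :: "'a set" and M N :: "'a measure"
  assumes w: "integrable lborel w" and norm_e: "norm e = 1" and open_\<Omega>: "open \<Omega>"
    and sets_M [measurable_cong, simp]: "sets M = sets borel"
    and sets_N [measurable_cong, simp]: "sets N = sets borel"
    and finite_M: "finite_measure M" and finite_N: "finite_measure N"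
    and integral_partial_deriv: "\<And>f L. bump_algebra f \<Longrightarrow> compact L \<Longrightarrow> L \<subseteq> \<Omega> \<Longrightarrow> (\<And>x. x \<notin> L \<Longrightarrow> f x = 0) \<Longrightarrow>
      (LINT x|lborel. w x * partial_deriv e f x) = - (integral\<^sup>L M f - integral\<^sup>L N f)"
begin

text \<open>For the Jordan parts \<open>M\<close> and \<open>N\<close> this is the total variation
  of the derivative, as a real number.\<close>

definition lam :: "'a set \<Rightarrow> real" where
  "lam W = measure M W + measure N W"

definition nu :: "('a \<Rightarrow> real) \<Rightarrow> real" where
  "nu f = integral\<^sup>L M f - integral\<^sup>L N f"

section \<open>Increment estimates and the limit of difference quotients\<close>

lemma w_measurable [measurable]: "w \<in> borel_measurable borel"
  using w by auto

lemma lam_nonneg: "lam W \<ge> 0"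
  by (simp add: lam_def)

lemma integrable_MN:
  fixes f :: "'a \<Rightarrow> real"
  assumes "f \<in> borel_measurable borel" "\<And>x. \<bar>f x\<bar> \<le> c"
  shows "integrable M f" "integrable N f"
proof -
  show "integrable M f" 
    using assms by (intro finite_measure.integrable_const_bound[OF finite_M, of _ c]) auto
  show "integrable N f" 
    using assms by (intro finite_measure.integrable_const_bound[OF finite_N, of _ c]) auto
qed

lemma nu_le:
  assumes f: "f \<in> borel_measurable borel" "\<And>x. \<bar>f x\<bar> \<le> c" "\<And>x. x \<notin> W \<Longrightarrow> f x = 0"
    and W: "W \<in> sets borel"
  shows "\<bar>nu f\<bar> \<le> c * lam W"
proof -
  interpret M: finite_measure M by (rule finite_M)
  interpret N: finite_measure N by (rule finite_N)
  have le: "\<bar>f x\<bar> \<le> c * indicator W x" for x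
    using f(2,3)[of x] by (auto simp: indicator_def)
  have "\<bar>integral\<^sup>L M f\<bar> \<le> (\<integral>x. \<bar>f x\<bar> \<partial>M)" by (rule integral_abs_bound)
  also have "\<dots> \<le> (\<integral>x. c * indicator W x \<partial>M)"
    using le W integrable_MN[OF f(1,2)] by (intro integral_mono) (auto simp: M.emeasure_eq_measure)
  also have "\<dots> = c * measure M W" using W by simp
  finally have 1: "\<bar>integral\<^sup>L M f\<bar> \<le> c * measure M W" .
  have "\<bar>integral\<^sup>L N f\<bar> \<le> (\<integral>x. \<bar>f x\<bar> \<partial>N)" by (rule integral_abs_bound)
  also have "\<dots> \<le> (\<integral>x. c * indicator W x \<partial>N)"
    using le W integrable_MN[OF f(1,2)] by (intro integral_mono) (auto simp: N.emeasure_eq_measure)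
  also have "\<dots> = c * measure N W" using W by simp
  finally have 2: "\<bar>integral\<^sup>L N f\<bar> \<le> c * measure N W" .
  show ?thesis using 1 2 unfolding nu_def lam_def by (simp add: distrib_left)
qed

text \<open>Differentiation under the integral: the mean value inequality bounds the difference
  quotients of \<open>f\<close> by the maximum \<open>C\<close> of its derivative, so
  \<open>C\<close> times the modulus of \<open>w\<close> dominates. All \<open>s\<close> are covered
  because the next estimate differentiates along the whole interval from 0 to
  \<open>h\<close>.\<close>

lemma DERIV_integral_shift:
  assumes f: "bump_algebra f" and L: "compact L" and f0: "\<And>x. x \<notin> L \<Longrightarrow> f x = 0"
  shows "((\<lambda>s. LINT x|lborel. w x * f (x + s *\<^sub>R e)) has_real_derivative
    (LINT x|lborel. w x * partial_deriv e f (x + s *\<^sub>R e))) (at s)"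
proof -
  let ?F = "\<lambda>s. LINT x|lborel. w x * f (x + s *\<^sub>R e)"
  have cont: "continuous_on UNIV f" "continuous_on UNIV (partial_deriv e f)"
    using f by (auto intro: bump_algebra_continuous bump_algebra_partial_deriv)
  note [measurable] = borel_measurable_continuous_onI[OF cont(1)] borel_measurable_continuous_onI[OF cont(2)]
  have pd0: "\<And>x. x \<notin> L \<Longrightarrow> partial_deriv e f x = 0"
    using partial_deriv_eq_0[OF f compact_imp_closed[OF L] f0] .
  obtain C where C: "C > 0" "\<And>x. \<bar>partial_deriv e f x\<bar> \<le> C"
    using bounded_if_compact_support[OF L cont(2) pd0] by blast
  obtain D where D: "D > 0" "\<And>x. \<bar>f x\<bar> \<le> D"
    using bounded_if_compact_support[OF L cont(1) f0] by blast
  have q: "\<bar>(f (x + (s + h) *\<^sub>R e) - f (x + s *\<^sub>R e)) / h\<bar> \<le> C" if "h \<noteq> 0" for x h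
  proof -
    have "norm (f (x + (s + h) *\<^sub>R e) - f (x + s *\<^sub>R e)) \<le> C * norm ((s + h) - s)"
      using C(2) by (intro field_differentiable_bound[where S=UNIV and f="\<lambda>t. f (x + t *\<^sub>R e)"
           and f'="\<lambda>t. partial_deriv e f (x + t *\<^sub>R e)"] bump_algebra_line_deriv f) auto
    then show ?thesis using that by (simp add: abs_divide divide_le_eq)
  qed
  have "((\<lambda>h. (?F (s + h) - ?F s) / h) \<longlongrightarrow>
      (LINT x|lborel. w x * partial_deriv e f (x + s *\<^sub>R e))) (at 0)"
    unfolding tendsto_at_iff_sequentially comp_def
  proof (intro allI impI)
    fix X :: "nat \<Rightarrow> real" assume X: "\<forall>i. X i \<in> UNIV - {0}" "X \<longlonglongrightarrow> 0"
    let ?q = "\<lambda>i x. (f (x + (s + X i) *\<^sub>R e) - f (x + s *\<^sub>R e)) / X i"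
    have "(?F (s + X i) - ?F s) / X i = (LINT x|lborel. w x * ?q i x)" for i
    proof -
      have "integrable lborel (\<lambda>x. w x * f (x + t *\<^sub>R e))" for t
        using w D(2) by (intro integrable_mult_bounded[where C=D]) auto
      then have "?F (s + X i) - ?F s = (LINT x|lborel. w x * f (x + (s + X i) *\<^sub>R e) - w x * f (x + s *\<^sub>R e))"
        by simp
      also have "\<dots> / X i = (LINT x|lborel. (w x * f (x + (s + X i) *\<^sub>R e) - w x * f (x + s *\<^sub>R e)) / X i)"
        by simp
      finally show ?thesis by (simp add: right_diff_distrib)
    qed
    moreover have "(\<lambda>i. LINT x|lborel. w x * ?q i x) \<longlonglongrightarrow>
        (LINT x|lborel. w x * partial_deriv e f (x + s *\<^sub>R e))"
    proof (rule integral_dominated_convergence[where w="\<lambda>x. C * \<bar>w x\<bar>"])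
      show "AE x in lborel. (\<lambda>i. w x * ?q i x) \<longlonglongrightarrow> w x * partial_deriv e f (x + s *\<^sub>R e)"
      proof (intro AE_I2 tendsto_mult_left)
        fix x
        have "((\<lambda>h. (f (x + (s + h) *\<^sub>R e) - f (x + s *\<^sub>R e)) / h) \<longlongrightarrow> partial_deriv e f (x + s *\<^sub>R e)) (at 0)"
          using bump_algebra_line_deriv[OF f, of x e s] unfolding DERIV_def .
        then show "(\<lambda>i. ?q i x) \<longlonglongrightarrow> partial_deriv e f (x + s *\<^sub>R e)"
          using X unfolding tendsto_at_iff_sequentially comp_def by blast
      qed
      show "AE x in lborel. norm (w x * ?q i x) \<le> C * \<bar>w x\<bar>" for i
      proof (intro AE_I2)
        fix x
        have "\<bar>?q i x\<bar> \<le> C" using q X(1) by blast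
        from mult_left_mono[OF this, of "\<bar>w x\<bar>"] show "norm (w x * ?q i x) \<le> C * \<bar>w x\<bar>"
          unfolding real_norm_def abs_mult[of "w x"] by (simp only: abs_ge_zero mult.commute[of C] True_implies_equals)
      qed
      show "integrable lborel (\<lambda>x. C * \<bar>w x\<bar>)" using w by auto
    qed measurable
    ultimately show "(\<lambda>i. (?F (s + X i) - ?F s) / X i) \<longlonglongrightarrow>
        (LINT x|lborel. w x * partial_deriv e f (x + s *\<^sub>R e))" by (simp only:)
  qed
  then show ?thesis by (simp add: DERIV_def)
qed

text \<open>Mean value inequality in the step size. The derivative at \<open>s\<close> is
  \<open>- nu\<close> of a translate of \<open>f\<close>; by \<open>LW\<close> its support,
  \<open>L\<close> shifted by \<open>- s\<close> in direction \<open>e\<close>, lies in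
  \<open>W\<close>, which bounds it by \<open>c * lam W\<close>.\<close>

lemma bump_increment_le:
  assumes f: "bump_algebra f" and L: "compact L" and f0: "\<And>x. x \<notin> L \<Longrightarrow> f x = 0"
    and c: "\<And>x. \<bar>f x\<bar> \<le> c" and W: "W \<in> sets borel" "W \<subseteq> \<Omega>" and h: "h \<ge> 0"
    and LW: "\<And>x s. x \<in> L \<Longrightarrow> 0 \<le> s \<Longrightarrow> s \<le> h \<Longrightarrow> x - s *\<^sub>R e \<in> W"
  shows "\<bar>LINT x|lborel. w x * (f (x + h *\<^sub>R e) - f x)\<bar> \<le> h * c * lam W"
proof -
  let ?F = "\<lambda>s. LINT x|lborel. w x * f (x + s *\<^sub>R e)"
  let ?F' = "\<lambda>s. LINT x|lborel. w x * partial_deriv e f (x + s *\<^sub>R e)"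
  have cont: "continuous_on UNIV f" by (rule bump_algebra_continuous[OF f])
  note [measurable] = borel_measurable_continuous_onI[OF cont]
  have bd: "norm (?F' s) \<le> c * lam W" if s: "s \<in> {0..h}" for s
  proof -
    let ?g = "\<lambda>x. f (x + s *\<^sub>R e)" and ?L = "(\<lambda>x. x - s *\<^sub>R e) ` L"
    have g0: "?g x = 0" if "x \<notin> ?L" for x
      by (rule f0) (use that in \<open>metis add_diff_cancel_right' image_eqI\<close>)
    have LsubW: "?L \<subseteq> W" using LW s by auto
    have "?F' s = (LINT x|lborel. w x * partial_deriv e ?g x)"
      by (simp add: partial_deriv_shift[OF f])
    also have "\<dots> = - nu ?g"
      unfolding nu_def using L LsubW W(2) g0
      by (intro integral_partial_deriv[where L="?L"] bump_algebra_shift f)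
         (auto intro!: compact_continuous_image continuous_intros)
    finally have "?F' s = - nu ?g" .
    moreover have "\<bar>nu ?g\<bar> \<le> c * lam W"
      using c g0 LsubW by (intro nu_le W(1)) auto
    ultimately show ?thesis by simp
  qed
  have "norm (?F h - ?F 0) \<le> c * lam W * norm (h - 0)"
    using bd h by (intro field_differentiable_bound[where S="{0..h}" and f="?F" and f'="?F'"])
      (auto intro!: has_field_derivative_at_within DERIV_integral_shift[OF f L f0])
  moreover have "integrable lborel (\<lambda>x. w x * f (x + t *\<^sub>R e))" for t
    using w c by (intro integrable_mult_bounded[where C=c]) auto
  from this[of h] this[of 0] have "?F h - ?F 0 = (LINT x|lborel. w x * (f (x + h *\<^sub>R e) - f x))"
    by (simp add: right_diff_distrib)
  ultimately show ?thesis using h by (simp add: mult_ac)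
qed

text \<open>For fixed \<open>h\<close> the integral is stable under uniform approximation of
  \<open>\<psi>\<close>, as \<open>w\<close> is integrable, so the bound passes to the limit.
  \<open>h0\<close> only has to keep the shifts of \<open>L'\<close> inside \<open>W\<close>, and
  therefore serves all \<open>\<psi>\<close> and \<open>c\<close> at once.\<close>

lemma continuous_increment_le:
  assumes L: "compact L" "L \<subseteq> W" and W: "open W" "W \<subseteq> \<Omega>"
  obtains h0 where "h0 > 0" "\<forall>h \<psi> c. 0 < h \<and> h < h0 \<and> continuous_on UNIV \<psi> \<and> (\<forall>x. x \<notin> L \<longrightarrow> \<psi> x = 0) \<and>
      (\<forall>x. \<bar>\<psi> x\<bar> \<le> c) \<longrightarrow> \<bar>LINT x|lborel. w x * (\<psi> (x + h *\<^sub>R e) - \<psi> x)\<bar> \<le> h * c * lam W"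
proof -
  obtain L' where L': "compact L'" "L' \<subseteq> W" "L \<subseteq> L'" and approx:
    "\<And>\<psi> \<epsilon>. continuous_on UNIV \<psi> \<Longrightarrow> (\<And>x. x \<notin> L \<Longrightarrow> \<psi> x = 0) \<Longrightarrow> \<epsilon> > 0 \<Longrightarrow>
       \<exists>f. bump_algebra f \<and> (\<forall>x. x \<notin> L' \<longrightarrow> f x = 0) \<and> (\<forall>x. \<bar>f x - \<psi> x\<bar> \<le> \<epsilon>)"
    using bump_algebra_dense[OF L W(1)] by metis
  obtain h0 where h0: "h0 > 0" "(\<Union>x\<in>L'. ball x h0) \<subseteq> W"
    using compact_subset_open_imp_ball_epsilon_subset[OF L'(1) W(1) L'(2)] by blast
  show thesis
  proof (rule that[OF h0(1)], intro allI impI, elim conjE)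
    fix h :: real and \<psi> :: "'a \<Rightarrow> real" and c :: real
    assume h: "0 < h" "h < h0" and \<psi>1: "continuous_on UNIV \<psi>" and "\<forall>x. x \<notin> L \<longrightarrow> \<psi> x = 0"
      and "\<forall>x. \<bar>\<psi> x\<bar> \<le> c"
    then have \<psi>: "continuous_on UNIV \<psi>" "\<And>x. x \<notin> L \<Longrightarrow> \<psi> x = 0" and c: "\<And>x. \<bar>\<psi> x\<bar> \<le> c" by auto
    note [measurable] = borel_measurable_continuous_onI[OF \<psi>(1)]
    show "\<bar>LINT x|lborel. w x * (\<psi> (x + h *\<^sub>R e) - \<psi> x)\<bar> \<le> h * c * lam W"
    \<comment> \<open>The first summand of \<open>k\<close> stems from the bound
      \<open>c + \<epsilon>\<close> for the approximant, the second from the integral of the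
      approximation error.\<close>
    proof (rule le_add_small_multiple[where k="h * lam W + 2 * (LINT x|lborel. \<bar>w x\<bar>)"])
      fix \<epsilon> :: real assume \<epsilon>: "\<epsilon> > 0"
      obtain f where f: "bump_algebra f" "\<And>x. x \<notin> L' \<Longrightarrow> f x = 0" "\<And>x. \<bar>f x - \<psi> x\<bar> \<le> \<epsilon>"
        using approx[OF \<psi> \<epsilon>] by blast
      note [measurable] = borel_measurable_continuous_onI[OF bump_algebra_continuous[OF f(1)]]
      have fc: "\<bar>f x\<bar> \<le> c + \<epsilon>" for x using f(3)[of x] c[of x] by linarith
      have "\<bar>LINT x|lborel. w x * (f (x + h *\<^sub>R e) - f x)\<bar> \<le> h * (c + \<epsilon>) * lam W"
      proof (rule bump_increment_le[OF f(1) L'(1) f(2) fc _ W(2)])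
        show "x - s *\<^sub>R e \<in> W" if "x \<in> L'" "0 \<le> s" "s \<le> h" for x s
        proof -
          have "x - s *\<^sub>R e \<in> ball x h0" using that h norm_e by (simp add: dist_norm)
          then show ?thesis using h0(2) that by blast
        qed
      qed (use h W in auto)
      moreover have "\<bar>LINT x|lborel. w x * ((\<psi> (x + h *\<^sub>R e) - f (x + h *\<^sub>R e)) - (\<psi> x - f x))\<bar>
          \<le> (2 * \<epsilon>) * (LINT x|lborel. \<bar>w x\<bar>)"
      proof (rule integral_mult_bounded_le[OF w])
        show "\<bar>(\<psi> (x + h *\<^sub>R e) - f (x + h *\<^sub>R e)) - (\<psi> x - f x)\<bar> \<le> 2 * \<epsilon>" for x
          by (intro abs_diff_le_double) (simp_all only: f(3) abs_minus_commute[of "\<psi> _"])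
      qed measurable
      moreover have "(LINT x|lborel. w x * (\<psi> (x + h *\<^sub>R e) - \<psi> x)) =
          (LINT x|lborel. w x * (f (x + h *\<^sub>R e) - f x)) +
          (LINT x|lborel. w x * ((\<psi> (x + h *\<^sub>R e) - f (x + h *\<^sub>R e)) - (\<psi> x - f x)))"
      proof -
        have "integrable lborel (\<lambda>x. w x * (f (x + h *\<^sub>R e) - f x))"
        proof (rule integrable_mult_bounded[OF w, where C="2 * (c + \<epsilon>)"])
          show "\<bar>f (x + h *\<^sub>R e) - f x\<bar> \<le> 2 * (c + \<epsilon>)" for x
            by (intro abs_diff_le_double fc)
        qed measurable
        moreover have "integrable lborel (\<lambda>x. w x * ((\<psi> (x + h *\<^sub>R e) - f (x + h *\<^sub>R e)) - (\<psi> x - f x)))"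
        proof (rule integrable_mult_bounded[OF w, where C="2 * \<epsilon>"])
          show "\<bar>(\<psi> (x + h *\<^sub>R e) - f (x + h *\<^sub>R e)) - (\<psi> x - f x)\<bar> \<le> 2 * \<epsilon>" for x
            by (intro abs_diff_le_double) (simp_all only: f(3) abs_minus_commute[of "\<psi> _"])
        qed measurable
        ultimately show ?thesis
          by (subst Bochner_Integration.integral_add[symmetric]) (auto simp: algebra_simps)
      qed
      ultimately show "\<bar>LINT x|lborel. w x * (\<psi> (x + h *\<^sub>R e) - \<psi> x)\<bar>
          \<le> h * c * lam W + \<epsilon> * (h * lam W + 2 * (LINT x|lborel. \<bar>w x\<bar>))"
        by (simp add: algebra_simps)
    qed
  qed
qed

(* For a Lipschitz function T the increments of T o w are a bounded multiple m of those of w; being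
   measurable, m is an almost everywhere limit of continuous functions. *)
lemma Lipschitz_increment_le:
  assumes L: "compact L" "L \<subseteq> W" and W: "open W" "W \<subseteq> \<Omega>"
  obtains h0 where "h0 > 0" "\<forall>h \<phi> T. 0 < h \<and> h < h0 \<and> continuous_on UNIV \<phi> \<and> (\<forall>x. x \<notin> L \<longrightarrow> \<phi> x = 0) \<and>
      (\<forall>x. \<bar>\<phi> x\<bar> \<le> 1) \<and> T \<in> borel_measurable borel \<and> T 0 = 0 \<and> (\<forall>a b. \<bar>T a - T b\<bar> \<le> \<bar>a - b\<bar>) \<longrightarrow>
      \<bar>LINT x|lborel. T (w x) * (\<phi> (x + h *\<^sub>R e) - \<phi> x)\<bar> \<le> h * lam W"
proof -
  obtain h0 where h0: "h0 > 0" and inc: "\<forall>h \<psi> c. 0 < h \<and> h < h0 \<and> continuous_on UNIV \<psi> \<and>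
      (\<forall>x. x \<notin> L \<longrightarrow> \<psi> x = 0) \<and> (\<forall>x. \<bar>\<psi> x\<bar> \<le> c) \<longrightarrow>
      \<bar>LINT x|lborel. w x * (\<psi> (x + h *\<^sub>R e) - \<psi> x)\<bar> \<le> h * c * lam W"
    by (rule continuous_increment_le[OF L W])
  show thesis
  proof (rule that[OF h0], intro allI impI, elim conjE)
    fix h :: real and \<phi> :: "'a \<Rightarrow> real" and T :: "real \<Rightarrow> real"
    assume h: "0 < h" "h < h0" and cont: "continuous_on UNIV \<phi>" and "\<forall>x. x \<notin> L \<longrightarrow> \<phi> x = 0"
      and "\<forall>x. \<bar>\<phi> x\<bar> \<le> 1" and T [measurable]: "T \<in> borel_measurable borel" and T0: "T 0 = 0"
      and "\<forall>a b. \<bar>T a - T b\<bar> \<le> \<bar>a - b\<bar>"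
    then have \<phi>: "continuous_on UNIV \<phi>" "\<And>x. x \<notin> L \<Longrightarrow> \<phi> x = 0" "\<And>x. \<bar>\<phi> x\<bar> \<le> 1"
      and T_Lip: "\<And>a b. \<bar>T a - T b\<bar> \<le> \<bar>a - b\<bar>" by auto
    note [measurable] = borel_measurable_continuous_onI[OF \<phi>(1)]
    have Tw: "integrable lborel (\<lambda>x. T (w x))"
      using T_Lip[of _ 0] T0 by (intro Bochner_Integration.integrable_bound[OF w]) auto
    define d where "d x = w (x - h *\<^sub>R e) - w x" for x
    \<comment> \<open>Where \<open>d x\<close> is 0 the quotient is 0 by convention, and the
      increment of \<open>T\<close> vanishes there too by the Lipschitz condition.\<close>
    define m where "m x = (T (w (x - h *\<^sub>R e)) - T (w x)) / d x" for x
    have [measurable]: "d \<in> borel_measurable borel" "m \<in> borel_measurable borel"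
      unfolding d_def[abs_def] m_def[abs_def] by measurable
    have m1: "\<bar>m x\<bar> \<le> 1" for x
      using T_Lip[of "w (x - h *\<^sub>R e)" "w x"] by (simp add: m_def d_def abs_divide divide_le_eq)
    have dm: "T (w (x - h *\<^sub>R e)) - T (w x) = d x * m x" for x
      using T_Lip[of "w (x - h *\<^sub>R e)" "w x"] by (cases "d x = 0") (auto simp: m_def d_def)
    have d: "integrable lborel d"
      unfolding d_def[abs_def] using w lborel_integrable_shift[OF w, of "- h *\<^sub>R e"] by simp
    have "m \<in> borel_measurable lebesgue" by (intro measurable_completion) simp
    then have "m measurable_on UNIV" by (rule lebesgue_measurable_imp_measurable_on) simp
    then obtain Z g where Z: "negligible Z" and g: "\<And>n. continuous_on UNIV (g n)"
      and lim: "\<And>x. x \<notin> Z \<Longrightarrow> (\<lambda>n. g n x) \<longlonglongrightarrow> m x"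
      unfolding measurable_on_def by auto
    \<comment> \<open>Clamping to the range of \<open>m\<close> leaves the limit unchanged and gives
      the bound 1, both for the dominating function and for \<open>inc\<close>.\<close>
    define k where "k n x = max (- 1) (min 1 (g n x))" for n x
    have k: "continuous_on UNIV (k n)" for n
      unfolding k_def[abs_def] using g by (intro continuous_intros)
    note [measurable] = borel_measurable_continuous_onI[OF k]
    have k1: "\<bar>k n x\<bar> \<le> 1" for n x by (auto simp: k_def)
    have klim: "(\<lambda>n. k n x) \<longlonglongrightarrow> m x" if "x \<notin> Z" for x
    proof -
      have "(\<lambda>n. k n x) \<longlonglongrightarrow> max (- 1) (min 1 (m x))"
        unfolding k_def using lim[OF that] by (intro tendsto_intros)
      moreover have "max (- 1) (min 1 (m x)) = m x" using m1[of x] by auto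
      ultimately show ?thesis by simp
    qed
    have AE_Z: "AE x in lborel. x \<notin> Z"
    proof -
      have "Z \<in> null_sets lebesgue" using Z negligible_iff_null_sets by blast
      then have "AE x in lebesgue. x \<notin> Z" by (rule AE_not_in)
      then show ?thesis by (simp add: AE_completion_iff)
    qed
    have "(\<lambda>n. LINT x|lborel. d x * (k n x * \<phi> x)) \<longlonglongrightarrow> (LINT x|lborel. d x * (m x * \<phi> x))"
    proof (rule integral_dominated_convergence[where w="\<lambda>x. \<bar>d x\<bar>"])
      show "AE x in lborel. (\<lambda>n. d x * (k n x * \<phi> x)) \<longlonglongrightarrow> d x * (m x * \<phi> x)"
        using AE_Z by eventually_elim (auto intro!: tendsto_intros klim)
      show "AE x in lborel. norm (d x * (k n x * \<phi> x)) \<le> \<bar>d x\<bar>" for n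
      proof (intro AE_I2)
        fix x
        have "\<bar>k n x * \<phi> x\<bar> \<le> 1 * 1" unfolding abs_mult using k1 \<phi>(3) by (intro mult_mono) auto
        from mult_left_mono[OF this, of "\<bar>d x\<bar>"] show "norm (d x * (k n x * \<phi> x)) \<le> \<bar>d x\<bar>"
          by (simp add: abs_mult)
      qed
    qed (use d in auto)
    moreover have "\<bar>LINT x|lborel. d x * (k n x * \<phi> x)\<bar> \<le> h * lam W" for n
    proof -
      let ?\<psi> = "\<lambda>x. k n x * \<phi> x"
      have le: "\<bar>?\<psi> x\<bar> \<le> 1" for x
        unfolding abs_mult using k1[of n x] \<phi>(3)[of x] by (simp add: mult_le_one)
      \<comment> \<open>The product of \<open>k n\<close> and \<open>\<phi>\<close> is continuous,
        bounded by 1 and zero off \<open>L\<close>, so it is admissible in \<open>inc\<close> with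
        the same \<open>h0\<close> for every \<open>n\<close>.\<close>
      have "(LINT x|lborel. w x * (?\<psi> (x + h *\<^sub>R e) - ?\<psi> x)) = (LINT x|lborel. d x * ?\<psi> x)"
        unfolding d_def using le by (intro lborel_integral_increment[OF w]) auto
      moreover have "\<bar>LINT x|lborel. w x * (?\<psi> (x + h *\<^sub>R e) - ?\<psi> x)\<bar> \<le> h * 1 * lam W"
        using h k \<phi> le by (intro inc[rule_format]) (auto intro!: continuous_intros)
      ultimately show ?thesis by simp
    qed
    ultimately have "\<bar>LINT x|lborel. d x * (m x * \<phi> x)\<bar> \<le> h * lam W"
      by (intro LIMSEQ_le_const2[OF tendsto_rabs]) auto
    moreover have "(LINT x|lborel. T (w x) * (\<phi> (x + h *\<^sub>R e) - \<phi> x)) = (LINT x|lborel. d x * (m x * \<phi> x))"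
      using lborel_integral_increment[OF Tw borel_measurable_continuous_onI[OF \<phi>(1)] \<phi>(3), of "h *\<^sub>R e"]
      by (simp add: dm mult.assoc)
    ultimately show "\<bar>LINT x|lborel. T (w x) * (\<phi> (x + h *\<^sub>R e) - \<phi> x)\<bar> \<le> h * lam W" by simp
  qed
qed

text \<open>For \<open>f\<close> in the algebra this is the derivative at 0 of the translated
  integral. For continuous \<open>\<phi>\<close> the crude error of an approximation would be
  divided by \<open>h\<close>; the increment estimate applied to the difference of \<open>f\<close>
  and \<open>\<phi>\<close> cancels this factor and makes the error uniform in
  \<open>h\<close>.\<close>

lemma difference_quotient_tendsto:
  assumes L: "compact L" "L \<subseteq> \<Omega>" and \<phi>: "continuous_on UNIV \<phi>" "\<And>x. x \<notin> L \<Longrightarrow> \<phi> x = 0"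
  shows "((\<lambda>h. (LINT x|lborel. w x * (\<phi> (x + h *\<^sub>R e) - \<phi> x)) / h) \<longlongrightarrow> - nu \<phi>) (at_right 0)"
proof (rule tendstoI)
  let ?A = "\<lambda>\<phi> h. (LINT x|lborel. w x * (\<phi> (x + h *\<^sub>R e) - \<phi> x)) / h"
  fix \<epsilon> :: real assume \<epsilon>: "\<epsilon> > 0"
  \<comment> \<open>Three errors of at most \<open>\<epsilon> / 4\<close> arise: replacing
    \<open>\<phi>\<close> by \<open>f\<close> in the quotient, the same in \<open>nu\<close>, and
    the limit for \<open>f\<close>.\<close>
  define \<eta> where "\<eta> = \<epsilon> / (4 * (lam \<Omega> + 1))"
  have \<eta>: "\<eta> > 0" "\<eta> * lam \<Omega> \<le> \<epsilon> / 4" using \<epsilon> lam_nonneg[of \<Omega>] by (auto simp: \<eta>_def field_simps)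
  note [measurable] = borel_measurable_continuous_onI[OF \<phi>(1)]
  obtain L' where L': "compact L'" "L' \<subseteq> \<Omega>" "L \<subseteq> L'" and "\<exists>f. bump_algebra f \<and> (\<forall>x. x \<notin> L' \<longrightarrow> f x = 0) \<and> (\<forall>x. \<bar>f x - \<phi> x\<bar> \<le> \<eta>)"
    using bump_algebra_dense[OF L open_\<Omega>] \<phi> \<eta>(1) by metis
  then obtain f where f: "bump_algebra f" "\<And>x. x \<notin> L' \<Longrightarrow> f x = 0" "\<And>x. \<bar>f x - \<phi> x\<bar> \<le> \<eta>"
    by blast
  have contf: "continuous_on UNIV f" by (rule bump_algebra_continuous[OF f(1)])
  note [measurable] = borel_measurable_continuous_onI[OF contf]
  obtain C where C: "\<And>x. \<bar>f x\<bar> \<le> C" using bounded_if_compact_support[OF L'(1) contf f(2)] by blast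
  obtain D where D: "\<And>x. \<bar>\<phi> x\<bar> \<le> D" using bounded_if_compact_support[OF L(1) \<phi>] by blast
  obtain h0 where h0: "h0 > 0" and inc: "\<forall>h \<psi> c. 0 < h \<and> h < h0 \<and> continuous_on UNIV \<psi> \<and>
      (\<forall>x. x \<notin> L' \<longrightarrow> \<psi> x = 0) \<and> (\<forall>x. \<bar>\<psi> x\<bar> \<le> c) \<longrightarrow>
      \<bar>LINT x|lborel. w x * (\<psi> (x + h *\<^sub>R e) - \<psi> x)\<bar> \<le> h * c * lam \<Omega>"
    by (rule continuous_increment_le[OF L'(1,2) open_\<Omega> order_refl])
  let ?\<psi> = "\<lambda>x. f x - \<phi> x"
  have int: "integrable lborel (\<lambda>x. w x * (\<phi> (x + h *\<^sub>R e) - \<phi> x))"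
    "integrable lborel (\<lambda>x. w x * (f (x + h *\<^sub>R e) - f x))" for h
  proof -
    have "\<bar>\<phi> (x + h *\<^sub>R e) - \<phi> x\<bar> \<le> 2 * D" "\<bar>f (x + h *\<^sub>R e) - f x\<bar> \<le> 2 * C" for x
      by (intro abs_diff_le_double C D)+
    then show "integrable lborel (\<lambda>x. w x * (\<phi> (x + h *\<^sub>R e) - \<phi> x))"
      "integrable lborel (\<lambda>x. w x * (f (x + h *\<^sub>R e) - f x))"
      by (auto intro!: integrable_mult_bounded[OF w])
  qed
  have d1: "\<bar>?A f h - ?A \<phi> h\<bar> \<le> \<epsilon> / 4" if "0 < h" "h < h0" for h
  proof -
    have "\<bar>LINT x|lborel. w x * (?\<psi> (x + h *\<^sub>R e) - ?\<psi> x)\<bar> \<le> h * \<eta> * lam \<Omega>"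
      using that \<phi>(1) contf f L'(3) \<phi>(2) by (intro inc[rule_format]) (auto intro!: continuous_intros)
    moreover have "(LINT x|lborel. w x * (?\<psi> (x + h *\<^sub>R e) - ?\<psi> x)) = h * (?A f h - ?A \<phi> h)"
    proof -
      have "h * (?A f h - ?A \<phi> h) = (LINT x|lborel. w x * (f (x + h *\<^sub>R e) - f x)) - (LINT x|lborel. w x * (\<phi> (x + h *\<^sub>R e) - \<phi> x))"
        using that by (simp add: right_diff_distrib)
      also have "\<dots> = (LINT x|lborel. w x * (f (x + h *\<^sub>R e) - f x) - w x * (\<phi> (x + h *\<^sub>R e) - \<phi> x))"
        using int by simp
      finally show ?thesis by (simp add: algebra_simps)
    qed
    ultimately have "h * \<bar>?A f h - ?A \<phi> h\<bar> \<le> h * (\<eta> * lam \<Omega>)"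
      using that by (simp only: abs_mult abs_of_pos mult.assoc)
    then show ?thesis using \<eta>(2) that(1) by simp
  qed
  have d2: "\<bar>nu f - nu \<phi>\<bar> \<le> \<epsilon> / 4"
  proof -
    have "\<bar>nu ?\<psi>\<bar> \<le> \<eta> * lam \<Omega>"
    proof (intro nu_le)
      show "f x - \<phi> x = 0" if "x \<notin> \<Omega>" for x
      proof -
        have "x \<notin> L'" "x \<notin> L" using that L'(2) L(2) by auto
        then show ?thesis using f(2) \<phi>(2) by simp
      qed
    qed (use f(3) open_\<Omega> in auto)
    moreover have "nu ?\<psi> = nu f - nu \<phi>"
    proof -
      have "integrable M f" "integrable N f" by (rule integrable_MN[where c=C]; use C in simp)+
      moreover have "integrable M \<phi>" "integrable N \<phi>" by (rule integrable_MN[where c=D]; use D in simp)+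
      ultimately show ?thesis unfolding nu_def by simp
    qed
    ultimately show ?thesis using \<eta>(2) by linarith
  qed
  have "((\<lambda>h. ?A f h) \<longlongrightarrow> - nu f) (at 0)"
  proof -
    have "integrable lborel (\<lambda>x. w x * f (x + t *\<^sub>R e))" for t
      using C by (intro integrable_mult_bounded[OF w]) auto
    from this this[of 0] show ?thesis
      using DERIV_integral_shift[OF f(1) L'(1) f(2), of 0] integral_partial_deriv[OF f(1) L'(1,2) f(2)]
      by (simp add: DERIV_def nu_def right_diff_distrib)
  qed
  then have "((\<lambda>h. ?A f h) \<longlongrightarrow> - nu f) (at_right 0)"
    by (rule tendsto_within_subset) simp
  then have "eventually (\<lambda>h. dist (?A f h) (- nu f) < \<epsilon> / 4) (at_right 0)"
    using \<epsilon> by (intro tendstoD) auto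
  moreover have "eventually (\<lambda>h. h < h0) (at_right 0)" "eventually (\<lambda>h. 0 < h) (at_right (0::real))"
    using h0 by (auto simp: eventually_at_right_field)
  ultimately show "eventually (\<lambda>h. dist (?A \<phi> h) (- nu \<phi>) < \<epsilon>) (at_right 0)"
  proof eventually_elim
    case (elim h)
    with d1[of h] d2 \<epsilon> show ?case unfolding dist_real_def by linarith
  qed
qed

end

subsection \<open>Compact sets of vanishing codimension one measure\<close>

text \<open>Vanishing of the (d-1)-dimensional Hausdorff measure for compact sets, in the form that
  cutoffs require. Centres in \<open>K\<close> and radii below \<open>r\<close> keep the enlarged
  balls in a prescribed neighbourhood of \<open>K\<close>.\<close>

definition null_by_balls :: "'a::euclidean_space set \<Rightarrow> bool" where
  "null_by_balls K \<longleftrightarrow> (\<forall>\<eta>>0. \<forall>r>0. \<exists>(I :: nat set) a \<rho>. finite I \<and> K \<subseteq> (\<Union>i\<in>I. ball (a i) (\<rho> i)) \<and>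
     (\<forall>i\<in>I. a i \<in> K \<and> 0 < \<rho> i \<and> \<rho> i < r) \<and> (\<Sum>i\<in>I. \<rho> i ^ (DIM('a) - 1)) < \<eta>)"

lemma abs_clamp_diff_le: "\<bar>max l (min u a) - max l (min u b)\<bar> \<le> \<bar>a - b\<bar>" for l u a b :: real
  by (auto simp: max_def min_def)

text \<open>A sum of tent functions, cut off at 1. The tent of ball \<open>i\<close> has Lipschitz
  constant \<open>1 / \<rho> i\<close> and vanishes outside the doubled ball; as
  \<open>h \<le> \<rho> i\<close>, its increment vanishes outside the tripled one.\<close>

lemma ball_cutoff:
  fixes a :: "'i \<Rightarrow> 'a::euclidean_space"
  assumes I: "finite I" and \<rho>: "\<And>i. i \<in> I \<Longrightarrow> 0 < \<rho> i" and e: "norm e = 1"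
  obtains \<kappa> :: "'a \<Rightarrow> real" where "continuous_on UNIV \<kappa>" "\<And>x. 0 \<le> \<kappa> x" "\<And>x. \<kappa> x \<le> 1"
    "\<And>x. x \<in> (\<Union>i\<in>I. ball (a i) (\<rho> i)) \<Longrightarrow> \<kappa> x = 1"
    "\<And>x. x \<notin> (\<Union>i\<in>I. ball (a i) (2 * \<rho> i)) \<Longrightarrow> \<kappa> x = 0"
    "\<And>h x. 0 < h \<Longrightarrow> (\<And>i. i \<in> I \<Longrightarrow> h \<le> \<rho> i) \<Longrightarrow>
       \<bar>\<kappa> (x + h *\<^sub>R e) - \<kappa> x\<bar> \<le> (\<Sum>i\<in>I. h / \<rho> i * indicator (cball (a i) (3 * \<rho> i)) x)"
proof -
  define k where "k i x = max 0 (min 1 (2 - dist (a i) x / \<rho> i))" for i x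
  define \<kappa> where "\<kappa> x = min 1 (\<Sum>i\<in>I. k i x)" for x
  have k: "0 \<le> k i x" "k i x \<le> 1" for i x by (auto simp: k_def)
  have k1: "k i x = 1" if "x \<in> ball (a i) (\<rho> i)" "i \<in> I" for i x
    using that \<rho>[of i] by (simp add: k_def divide_le_eq min_def le_diff_eq)
  have k0: "k i x = 0" if "x \<notin> ball (a i) (2 * \<rho> i)" "i \<in> I" for i x
    using that \<rho>[of i] by (simp add: k_def le_divide_eq)
  show thesis
  proof (rule that[of \<kappa>])
    show "continuous_on UNIV \<kappa>"
      unfolding \<kappa>_def k_def using I \<rho> by (intro continuous_intros) force+
    show "0 \<le> \<kappa> x" "\<kappa> x \<le> 1" for x
      using k by (auto simp: \<kappa>_def sum_nonneg)
    show "\<kappa> x = 1" if x: "x \<in> (\<Union>i\<in>I. ball (a i) (\<rho> i))" for x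
    proof -
      obtain j where j: "j \<in> I" "k j x = 1" using x k1 by blast
      have "k j x \<le> (\<Sum>i\<in>I. k i x)" using I j(1) k by (intro member_le_sum) auto
      then show ?thesis using j by (simp add: \<kappa>_def)
    qed
    show "\<kappa> x = 0" if "x \<notin> (\<Union>i\<in>I. ball (a i) (2 * \<rho> i))" for x
    proof -
      have "(\<Sum>i\<in>I. k i x) = 0" using that k0 by (intro sum.neutral) blast
      then show ?thesis by (simp add: \<kappa>_def)
    qed
    fix h :: real and x :: 'a
    assume h: "0 < h" "\<And>i. i \<in> I \<Longrightarrow> h \<le> \<rho> i"
    have d: "dist (x + h *\<^sub>R e) x = h" using h(1) e by (simp add: dist_norm)
    have "\<bar>k i (x + h *\<^sub>R e) - k i x\<bar> \<le> h / \<rho> i * indicator (cball (a i) (3 * \<rho> i)) x" if i: "i \<in> I" for i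
    proof (cases "x \<in> cball (a i) (3 * \<rho> i)")
      case True
      have "\<bar>dist (a i) (x + h *\<^sub>R e) - dist (a i) x\<bar> \<le> h"
        using abs_dist_diff_le[of "x + h *\<^sub>R e" "a i" x] d by (simp add: dist_commute)
      then have "\<bar>(2 - dist (a i) (x + h *\<^sub>R e) / \<rho> i) - (2 - dist (a i) x / \<rho> i)\<bar> \<le> h / \<rho> i"
        using \<rho>[OF i] by (simp add: diff_divide_distrib[symmetric] abs_divide divide_right_mono abs_minus_commute)
      then show ?thesis
        using abs_clamp_diff_le order_trans True unfolding k_def by fastforce
    next
      case False
      have "dist (a i) x \<le> dist (a i) (x + h *\<^sub>R e) + h"
        using dist_triangle[of "a i" x "x + h *\<^sub>R e"] d by simp
      then have "x + h *\<^sub>R e \<notin> ball (a i) (2 * \<rho> i)" "x \<notin> ball (a i) (2 * \<rho> i)"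
        using False h(2)[OF i] \<rho>[OF i] by auto
      then show ?thesis using k0 i False by simp
    qed
    then have "(\<Sum>i\<in>I. \<bar>k i (x + h *\<^sub>R e) - k i x\<bar>) \<le> (\<Sum>i\<in>I. h / \<rho> i * indicator (cball (a i) (3 * \<rho> i)) x)"
      by (rule sum_mono)
    moreover have "\<bar>(\<Sum>i\<in>I. k i (x + h *\<^sub>R e)) - (\<Sum>i\<in>I. k i x)\<bar> \<le> (\<Sum>i\<in>I. \<bar>k i (x + h *\<^sub>R e) - k i x\<bar>)"
      unfolding sum_subtractf[symmetric] by (rule sum_abs)
    ultimately show "\<bar>\<kappa> (x + h *\<^sub>R e) - \<kappa> x\<bar> \<le> (\<Sum>i\<in>I. h / \<rho> i * indicator (cball (a i) (3 * \<rho> i)) x)"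
      unfolding \<kappa>_def by linarith
  qed
qed

text \<open>Codimension one enters here: the volume of a ball is of order
  \<open>\<rho> i ^ DIM('a)\<close>, and the slope \<open>1 / \<rho> i\<close> of the cutoff takes
  away one power.\<close>

lemma integral_sum_cball:
  fixes a :: "'i \<Rightarrow> 'a::euclidean_space" and \<rho> :: "'i \<Rightarrow> real"
  assumes "finite I" "\<And>i. i \<in> I \<Longrightarrow> 0 < \<rho> i"
  shows "integrable lborel (\<lambda>x. \<Sum>i\<in>I. h / \<rho> i * indicator (cball (a i) (3 * \<rho> i)) x)"
    and "(LINT x|lborel. (\<Sum>i\<in>I. h / \<rho> i * indicator (cball (a i) (3 * \<rho> i)) x)) =
      h * (unit_ball_vol (real DIM('a)) * 3 ^ DIM('a)) * (\<Sum>i\<in>I. \<rho> i ^ (DIM('a) - 1))"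
proof -
  have i: "integrable lborel (\<lambda>x. h / \<rho> i * indicator (cball (a i) (3 * \<rho> i)) x)" for i
    using emeasure_lborel_cball_finite[of "a i" "3 * \<rho> i"]
    by (intro integrable_mult_right integrable_real_indicator) (auto simp: less_top)
  then show "integrable lborel (\<lambda>x. \<Sum>i\<in>I. h / \<rho> i * indicator (cball (a i) (3 * \<rho> i)) x)"
    by (intro Bochner_Integration.integrable_sum)
  have "(LINT x|lborel. (\<Sum>i\<in>I. h / \<rho> i * indicator (cball (a i) (3 * \<rho> i)) x)) =
      (\<Sum>i\<in>I. LINT x|lborel. h / \<rho> i * indicator (cball (a i) (3 * \<rho> i)) x)"
    using i by (intro Bochner_Integration.integral_sum)
  also have "\<dots> = (\<Sum>i\<in>I. h * (unit_ball_vol (real DIM('a)) * 3 ^ DIM('a)) * \<rho> i ^ (DIM('a) - 1))"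
  proof (rule sum.cong[OF refl])
    fix i assume "i \<in> I"
    then have \<rho>: "0 < \<rho> i" by (rule assms)
    have "\<rho> i ^ DIM('a) = \<rho> i * \<rho> i ^ (DIM('a) - 1)"
      using DIM_positive[where 'a='a] by (metis power_eq_if less_irrefl)
    then show "(LINT x|lborel. h / \<rho> i * indicator (cball (a i) (3 * \<rho> i)) x) =
        h * (unit_ball_vol (real DIM('a)) * 3 ^ DIM('a)) * \<rho> i ^ (DIM('a) - 1)"
      using \<rho> content_cball[of "3 * \<rho> i" "a i"] by (simp add: power_mult_distrib)
  qed
  finally show "(LINT x|lborel. (\<Sum>i\<in>I. h / \<rho> i * indicator (cball (a i) (3 * \<rho> i)) x)) =
      h * (unit_ball_vol (real DIM('a)) * 3 ^ DIM('a)) * (\<Sum>i\<in>I. \<rho> i ^ (DIM('a) - 1))"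
    by (simp add: sum_distrib_left)
qed

section \<open>From cutoff functions to compact null sets\<close>

context line_derivative_measure
begin

(* The cutoff function kappa is 1 near K and the integral of its increments is controlled by the covering;
   phi - kappa is supported away from K, so its contribution does not see K. *)
lemma truncated_increment_le:
  assumes K: "null_by_balls K"
    and L: "compact L" "L \<subseteq> U" and U: "open U" "U \<subseteq> \<Omega>"
    and \<phi>: "continuous_on UNIV \<phi>" "\<And>x. x \<notin> L \<Longrightarrow> \<phi> x = 0" "\<And>x. 0 \<le> \<phi> x" "\<And>x. \<phi> x \<le> 1"
    and r: "r > 0" "\<And>x y. x \<in> K \<Longrightarrow> y \<in> ball x r \<Longrightarrow> \<phi> y = 1" and cK: "compact K"
    and T: "T \<in> borel_measurable borel" "T 0 = 0" "\<And>a b. \<bar>T a - T b\<bar> \<le> \<bar>a - b\<bar>" "\<And>a. \<bar>T a\<bar> \<le> B"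
    and \<eta>: "\<eta> > 0"
  shows "eventually (\<lambda>h. \<bar>LINT x|lborel. T (w x) * (\<phi> (x + h *\<^sub>R e) - \<phi> x)\<bar> \<le> h * (lam (U - K) + \<eta>)) (at_right 0)"
proof -
  note [measurable] = T(1) borel_measurable_continuous_onI[OF \<phi>(1)]
  define C where "C = unit_ball_vol (real DIM('a)) * 3 ^ DIM('a)"
  have B: "B \<ge> 0" using T(4)[of 0] by simp
  have C: "C \<ge> 0" unfolding C_def by simp
  \<comment> \<open>\<open>B * C\<close> is the factor between the sum over the cover and the
    integral with \<open>\<kappa>\<close>; the summand 1 allows it to be 0.\<close>
  define \<eta>' where "\<eta>' = \<eta> / (B * C + 1)"
  have "B * C + 1 > 0" using B C by (simp add: add_nonneg_pos)
  then have \<eta>': "\<eta>' > 0" "B * C * \<eta>' \<le> \<eta>"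
    using \<eta> by (auto simp: \<eta>'_def field_simps)
  \<comment> \<open>Radii below \<open>r / 2\<close> put the doubled balls, and so the support of
    \<open>\<kappa>\<close>, into the region where \<open>\<phi>\<close> is 1.\<close>
  obtain I :: "nat set" and a \<rho> where I: "finite I" and cov: "K \<subseteq> (\<Union>i\<in>I. ball (a i) (\<rho> i))"
    and a: "\<And>i. i \<in> I \<Longrightarrow> a i \<in> K" and \<rho>: "\<And>i. i \<in> I \<Longrightarrow> 0 < \<rho> i" "\<And>i. i \<in> I \<Longrightarrow> \<rho> i < r / 2"
    and sum: "(\<Sum>i\<in>I. \<rho> i ^ (DIM('a) - 1)) < \<eta>'"
    using K[unfolded null_by_balls_def, rule_format, OF \<eta>'(1), of "r / 2"] r(1) by auto
  obtain \<kappa> :: "'a \<Rightarrow> real" where \<kappa>: "continuous_on UNIV \<kappa>" "\<And>x. 0 \<le> \<kappa> x" "\<And>x. \<kappa> x \<le> 1"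
    "\<And>x. x \<in> (\<Union>i\<in>I. ball (a i) (\<rho> i)) \<Longrightarrow> \<kappa> x = 1"
    "\<And>x. x \<notin> (\<Union>i\<in>I. ball (a i) (2 * \<rho> i)) \<Longrightarrow> \<kappa> x = 0"
    and \<kappa>_inc: "\<And>h x. 0 < h \<Longrightarrow> (\<And>i. i \<in> I \<Longrightarrow> h \<le> \<rho> i) \<Longrightarrow>
       \<bar>\<kappa> (x + h *\<^sub>R e) - \<kappa> x\<bar> \<le> (\<Sum>i\<in>I. h / \<rho> i * indicator (cball (a i) (3 * \<rho> i)) x)"
    using ball_cutoff[where I=I and \<rho>=\<rho> and a=a and e=e, OF I \<rho>(1) norm_e] by blast
  note [measurable] = borel_measurable_continuous_onI[OF \<kappa>(1)]
  let ?D = "L - (\<Union>i\<in>I. ball (a i) (\<rho> i))"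
  let ?\<psi> = "\<lambda>x. \<phi> x - \<kappa> x"
  have \<phi>1: "\<phi> x = 1" if x: "x \<in> (\<Union>i\<in>I. ball (a i) (2 * \<rho> i))" for x
  proof -
    obtain i where i: "i \<in> I" "x \<in> ball (a i) (2 * \<rho> i)" using x by blast
    then have "x \<in> ball (a i) r" using \<rho>(2)[OF i(1)] by simp
    then show ?thesis using r(2) a i(1) by blast
  qed
  have sub: "(\<Union>i\<in>I. ball (a i) (\<rho> i)) \<subseteq> (\<Union>i\<in>I. ball (a i) (2 * \<rho> i))"
    using \<rho>(1) by (fastforce simp: subset_eq)
  \<comment> \<open>On the covering balls both functions are 1. Off \<open>L\<close> the value of
    \<open>\<phi>\<close> is 0, which excludes the doubled balls, so \<open>\<kappa>\<close> is 0
    too.\<close>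
  have \<psi>0: "?\<psi> x = 0" if "x \<notin> ?D" for x
  proof (cases "x \<in> L")
    case True
    then have x: "x \<in> (\<Union>i\<in>I. ball (a i) (\<rho> i))" using that by blast
    then have "x \<in> (\<Union>i\<in>I. ball (a i) (2 * \<rho> i))" using sub by blast
    then show ?thesis using \<kappa>(4)[OF x] \<phi>1 by simp
  next
    case False
    then have "\<phi> x = 0" by (rule \<phi>(2))
    then have "x \<notin> (\<Union>i\<in>I. ball (a i) (2 * \<rho> i))" using \<phi>1[of x] by auto
    then show ?thesis using \<open>\<phi> x = 0\<close> \<kappa>(5)[of x] by simp
  qed
  have \<psi>1: "\<bar>?\<psi> x\<bar> \<le> 1" for x
    using \<kappa>(2,3)[of x] \<phi>(3,4)[of x] by linarith
  have D: "compact ?D" using L(1) by (intro compact_diff) auto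
  have DU: "?D \<subseteq> U - K" using L(2) cov by blast
  have UK: "open (U - K)" "U - K \<subseteq> \<Omega>"
    using U cK by (auto intro: open_Diff compact_imp_closed)
  obtain h0 where h0: "h0 > 0" and inc: "\<forall>h \<phi> T. 0 < h \<and> h < h0 \<and> continuous_on UNIV \<phi> \<and> (\<forall>x. x \<notin> ?D \<longrightarrow> \<phi> x = 0) \<and>
      (\<forall>x. \<bar>\<phi> x\<bar> \<le> 1) \<and> T \<in> borel_measurable borel \<and> T 0 = 0 \<and> (\<forall>a b. \<bar>T a - T b\<bar> \<le> \<bar>a - b\<bar>) \<longrightarrow>
      \<bar>LINT x|lborel. T (w x) * (\<phi> (x + h *\<^sub>R e) - \<phi> x)\<bar> \<le> h * lam (U - K)"
    by (rule Lipschitz_increment_le[OF D DU UK])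
  have "eventually (\<lambda>h. h < h0) (at_right 0)" "eventually (\<lambda>h. 0 < h) (at_right (0::real))"
    using h0 by (auto simp: eventually_at_right_field)
  \<comment> \<open>The step must be below the smallest radius of the cover, so the admissible range
    of \<open>h\<close> depends on \<open>\<eta>\<close> and \<open>B\<close>.\<close>
  moreover have "eventually (\<lambda>h. \<forall>i\<in>I. h < \<rho> i) (at_right 0)"
    using I \<rho>(1) by (intro eventually_ball_finite) (auto simp: eventually_at_right_field)
  ultimately show ?thesis
  proof eventually_elim
    case (elim h)
    have Tw: "integrable lborel (\<lambda>x. T (w x))"
      using T(3)[of _ 0] T(2) by (intro Bochner_Integration.integrable_bound[OF w]) auto
    have 1: "\<bar>LINT x|lborel. T (w x) * (?\<psi> (x + h *\<^sub>R e) - ?\<psi> x)\<bar> \<le> h * lam (U - K)"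
      using elim T \<psi>1 \<psi>0 \<phi>(1) \<kappa>(1) by (intro inc[rule_format]) (auto intro!: continuous_intros)
    have pt: "\<bar>T (w x) * (\<kappa> (x + h *\<^sub>R e) - \<kappa> x)\<bar> \<le>
        B * (\<Sum>i\<in>I. h / \<rho> i * indicator (cball (a i) (3 * \<rho> i)) x)" for x
      unfolding abs_mult using elim B by (intro mult_mono T(4) \<kappa>_inc) auto
    have i: "integrable lborel (\<lambda>x. B * (\<Sum>i\<in>I. h / \<rho> i * indicator (cball (a i) (3 * \<rho> i)) x))"
      using integral_sum_cball(1)[of I \<rho>, OF I \<rho>(1)] by (rule integrable_mult_right)
    have i2: "integrable lborel (\<lambda>x. T (w x) * (\<kappa> (x + h *\<^sub>R e) - \<kappa> x))"
    proof (rule integrable_mult_bounded[OF Tw])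
      show "\<bar>\<kappa> (x + h *\<^sub>R e) - \<kappa> x\<bar> \<le> 1" for x
        using \<kappa>(2,3)[of x] \<kappa>(2,3)[of "x + h *\<^sub>R e"] by linarith
    qed measurable
    have i3: "integrable lborel (\<lambda>x. T (w x) * (?\<psi> (x + h *\<^sub>R e) - ?\<psi> x))"
    proof (rule integrable_mult_bounded[OF Tw])
      show "\<bar>?\<psi> (x + h *\<^sub>R e) - ?\<psi> x\<bar> \<le> 2 * 1" for x
        by (intro abs_diff_le_double \<psi>1)
    qed measurable
    have "\<bar>LINT x|lborel. T (w x) * (\<kappa> (x + h *\<^sub>R e) - \<kappa> x)\<bar> \<le>
        (LINT x|lborel. \<bar>T (w x) * (\<kappa> (x + h *\<^sub>R e) - \<kappa> x)\<bar>)"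
      by (rule integral_abs_bound)
    also have "\<dots> \<le> (LINT x|lborel. B * (\<Sum>i\<in>I. h / \<rho> i * indicator (cball (a i) (3 * \<rho> i)) x))"
      using i i2 pt by (intro integral_mono integrable_abs) auto
    also have "\<dots> = h * (B * C * (\<Sum>i\<in>I. \<rho> i ^ (DIM('a) - 1)))"
    proof -
      have "(LINT x|lborel. (\<Sum>i\<in>I. h / \<rho> i * indicator (cball (a i) (3 * \<rho> i)) x)) =
          h * C * (\<Sum>i\<in>I. \<rho> i ^ (DIM('a) - 1))"
        unfolding C_def using I \<rho>(1) by (rule integral_sum_cball(2))
      then show ?thesis unfolding integral_mult_right_zero by (simp only: mult_ac)
    qed
    also have "\<dots> \<le> h * (B * C * \<eta>')"
      using elim sum B C by (intro mult_left_mono mult_nonneg_nonneg) auto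
    also have "\<dots> \<le> h * \<eta>"
      using elim \<eta>'(2) by (intro mult_left_mono) auto
    finally have 2: "\<bar>LINT x|lborel. T (w x) * (\<kappa> (x + h *\<^sub>R e) - \<kappa> x)\<bar> \<le> h * \<eta>" .
    have "(LINT x|lborel. T (w x) * (\<phi> (x + h *\<^sub>R e) - \<phi> x)) =
      (LINT x|lborel. T (w x) * (?\<psi> (x + h *\<^sub>R e) - ?\<psi> x)) + (LINT x|lborel. T (w x) * (\<kappa> (x + h *\<^sub>R e) - \<kappa> x))"
      using i2 i3 by (subst Bochner_Integration.integral_add[symmetric]) (auto simp: algebra_simps)
    then show ?case using 1 2 by (simp add: distrib_left)
  qed
qed

text \<open>The increment of \<open>\<phi>\<close> is at most \<open>\<Lambda> * h\<close>, so the
  part of \<open>w\<close> lost by truncation contributes at most \<open>\<Lambda> * t n\<close> to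
  the difference quotient, for every \<open>h\<close>. The limits are taken in the order
  \<open>h\<close>, \<open>n\<close>, \<open>\<eta>\<close>.\<close>

lemma nu_cutoff_le:
  assumes K: "null_by_balls K" "compact K"
    and L: "compact L" "L \<subseteq> U" and U: "open U" "U \<subseteq> \<Omega>"
    and \<phi>: "\<And>x. x \<notin> L \<Longrightarrow> \<phi> x = 0" "\<And>x. 0 \<le> \<phi> x" "\<And>x. \<phi> x \<le> 1"
    and r: "r > 0" "\<And>x y. x \<in> K \<Longrightarrow> y \<in> ball x r \<Longrightarrow> \<phi> y = 1"
    and Lip: "\<Lambda>-lipschitz_on UNIV \<phi>"
  shows "\<bar>nu \<phi>\<bar> \<le> lam (U - K)"
proof -
  have cont: "continuous_on UNIV \<phi>" using Lip by (rule lipschitz_on_continuous_on)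
  note [measurable] = borel_measurable_continuous_onI[OF cont]
  define T :: "nat \<Rightarrow> real \<Rightarrow> real" where "T n = (\<lambda>a. max (- real n) (min (real n) a))" for n
  have T: "T n \<in> borel_measurable borel" "T n 0 = 0" "\<bar>T n a - T n b\<bar> \<le> \<bar>a - b\<bar>" "\<bar>T n a\<bar> \<le> real n" for n a b
    unfolding T_def using abs_clamp_diff_le by auto
  note [measurable] = T(1)
  define t where "t n = (LINT x|lborel. \<bar>w x - T n (w x)\<bar>)" for n
  have Tw: "integrable lborel (\<lambda>x. T n (w x))" for n
    using T(3)[of n _ 0] T(2) by (intro Bochner_Integration.integrable_bound[OF w]) auto
  have "t \<longlonglongrightarrow> (LINT x::'a|lborel. 0)"
    unfolding t_def
  proof (rule integral_dominated_convergence[where w="\<lambda>x. 2 * \<bar>w x\<bar>"])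
    show "AE x in lborel. (\<lambda>n. \<bar>w x - T n (w x)\<bar>) \<longlonglongrightarrow> 0"
    proof (intro AE_I2 tendsto_eventually)
      fix x
      show "\<forall>\<^sub>F n in sequentially. \<bar>w x - T n (w x)\<bar> = 0"
        using eventually_ge_at_top[of "nat \<lceil>\<bar>w x\<bar>\<rceil>"]
      proof eventually_elim
        case (elim n)
        then have "\<bar>w x\<bar> \<le> real n" by linarith
        then show ?case by (auto simp: T_def)
      qed
    qed
    show "AE x in lborel. norm \<bar>w x - T n (w x)\<bar> \<le> 2 * \<bar>w x\<bar>" for n
    proof (intro AE_I2)
      fix x
      have "\<bar>T n (w x)\<bar> \<le> \<bar>w x\<bar>" using T(3)[of n "w x" 0] T(2) by simp
      then show "norm \<bar>w x - T n (w x)\<bar> \<le> 2 * \<bar>w x\<bar>" by simp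
    qed
  qed (use w in auto)
  then have t: "t \<longlonglongrightarrow> 0" by simp
  have \<Lambda>: "\<bar>\<phi> (x + h *\<^sub>R e) - \<phi> x\<bar> \<le> \<Lambda> * h" if "h > 0" for x h
    using lipschitz_onD[OF Lip, of "x + h *\<^sub>R e" x] that norm_e by (simp add: dist_norm)
  have lim: "((\<lambda>h. \<bar>(LINT x|lborel. w x * (\<phi> (x + h *\<^sub>R e) - \<phi> x)) / h\<bar>) \<longlongrightarrow> \<bar>- nu \<phi>\<bar>) (at_right 0)"
    using L U cont \<phi>(1) by (intro tendsto_rabs difference_quotient_tendsto[where L=L]) auto
  have main: "\<bar>nu \<phi>\<bar> \<le> lam (U - K) + \<eta> + \<Lambda> * t n" if \<eta>: "\<eta> > 0" for \<eta> n
  proof -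
    have "eventually (\<lambda>h. \<bar>LINT x|lborel. T n (w x) * (\<phi> (x + h *\<^sub>R e) - \<phi> x)\<bar> \<le> h * (lam (U - K) + \<eta>)) (at_right 0)"
      using T by (intro truncated_increment_le[OF K(1) L U cont \<phi> r K(2) _ _ _ _ \<eta>]) auto
    moreover have "eventually (\<lambda>h. 0 < h) (at_right (0::real))"
      by (rule eventually_at_right_less)
    ultimately have "eventually (\<lambda>h. \<bar>(LINT x|lborel. w x * (\<phi> (x + h *\<^sub>R e) - \<phi> x)) / h\<bar>
        \<le> lam (U - K) + \<eta> + \<Lambda> * t n) (at_right 0)"
    proof eventually_elim
      case (elim h)
      have i: "integrable lborel (\<lambda>x. T n (w x) * (\<phi> (x + h *\<^sub>R e) - \<phi> x))"
        using \<Lambda>[OF elim(2)] by (intro integrable_mult_bounded[OF Tw]) auto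
      have d: "integrable lborel (\<lambda>x. w x - T n (w x))" using w Tw by simp
      have i': "integrable lborel (\<lambda>x. (w x - T n (w x)) * (\<phi> (x + h *\<^sub>R e) - \<phi> x))"
        using \<Lambda>[OF elim(2)] by (intro integrable_mult_bounded[OF d]) auto
      have "\<bar>LINT x|lborel. (w x - T n (w x)) * (\<phi> (x + h *\<^sub>R e) - \<phi> x)\<bar> \<le> \<Lambda> * h * t n"
        unfolding t_def using \<Lambda>[OF elim(2)] by (intro integral_mult_bounded_le[OF d]) auto
      moreover have "(LINT x|lborel. w x * (\<phi> (x + h *\<^sub>R e) - \<phi> x)) =
          (LINT x|lborel. T n (w x) * (\<phi> (x + h *\<^sub>R e) - \<phi> x)) +
          (LINT x|lborel. (w x - T n (w x)) * (\<phi> (x + h *\<^sub>R e) - \<phi> x))"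
        using i i' by (subst Bochner_Integration.integral_add[symmetric]) (auto simp: algebra_simps)
      ultimately have "\<bar>LINT x|lborel. w x * (\<phi> (x + h *\<^sub>R e) - \<phi> x)\<bar> \<le> h * (lam (U - K) + \<eta> + \<Lambda> * t n)"
        using elim(1) by (simp add: algebra_simps)
      then show ?case using elim(2) by (simp add: abs_divide divide_le_eq mult.commute)
    qed
    from tendsto_upperbound[OF lim this] show ?thesis by simp
  qed
  show ?thesis
  proof (rule le_add_small_multiple[where k=1])
    fix \<eta> :: real assume \<eta>: "\<eta> > 0"
    have "(\<lambda>n. lam (U - K) + \<eta> + \<Lambda> * t n) \<longlonglongrightarrow> lam (U - K) + \<eta> + \<Lambda> * 0"
      by (intro tendsto_intros t)
    then show "\<bar>nu \<phi>\<bar> \<le> lam (U - K) + \<eta> * 1"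
      using main[OF \<eta>] by (intro LIMSEQ_le_const[where X="\<lambda>n. lam (U - K) + \<eta> + \<Lambda> * t n"]) auto
  qed
qed

text \<open>The cutoffs converge pointwise to the indicator of \<open>K\<close>, so
  \<open>nu\<close> of them tends to the difference of the two measures of \<open>K\<close>; at the
  same time it is bounded by \<open>lam (U n - K)\<close>, which tends to 0 because the
  \<open>U n\<close> shrink to \<open>K\<close>.\<close>

lemma measure_null_compact_eq:
  assumes K: "null_by_balls K" "compact K" "K \<subseteq> \<Omega>"
  shows "measure M K = measure N K"
\<comment> \<open>The empty set is split off because \<open>infdist\<close> to it is 0
  everywhere.\<close>
proof (cases "K = {}")
  case False
  interpret M: finite_measure M by (rule finite_M)
  interpret N: finite_measure N by (rule finite_N)
  obtain d where d: "d > 0" "{x. infdist x K \<le> d} \<subseteq> \<Omega>"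
    using compact_in_open_separated[OF False K(2) open_\<Omega> K(3)] by blast
  \<comment> \<open>Three nested layers around \<open>K\<close> have to fit into distance
    \<open>d\<close>: \<open>\<phi> n\<close> is 1 up to \<open>s n\<close> and vanishes beyond
    \<open>2 * s n\<close>, and the open set \<open>U n\<close> reaches to
    \<open>3 * s n\<close>.\<close>
  define s where "s n = d / (3 * real (Suc n))" for n
  have s: "s n > 0" for n using d by (simp add: s_def)
  have s3: "3 * s n \<le> d" for n using d by (simp add: s_def field_simps)
  have sdec: "s n \<le> s m" if "m \<le> n" for m n
    using that d unfolding s_def by (intro divide_left_mono) auto
  have s0: "s \<longlonglongrightarrow> 0"
    unfolding s_def[abs_def] using tendsto_mult_right_zero[OF LIMSEQ_inverse_real_of_nat, of "d / 3"]
    by (simp add: field_simps)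
  define \<phi> where "\<phi> n x = max 0 (min 1 (2 - infdist x K / s n))" for n x
  define L where "L n = {x. infdist x K \<le> 2 * s n}" for n
  define U where "U n = {x. infdist x K < 3 * s n}" for n
  have Lip: "(1 / s n)-lipschitz_on UNIV (\<phi> n)" for n
  proof (rule lipschitz_onI)
    fix x y
    have "\<bar>infdist x K - infdist y K\<bar> \<le> dist x y" by (rule infdist_triangle_abs)
    then have "\<bar>(2 - infdist x K / s n) - (2 - infdist y K / s n)\<bar> \<le> 1 / s n * dist x y"
      using s[of n] by (simp add: diff_divide_distrib[symmetric] abs_divide divide_right_mono abs_minus_commute)
    then show "dist (\<phi> n x) (\<phi> n y) \<le> 1 / s n * dist x y"
      unfolding \<phi>_def dist_real_def using abs_clamp_diff_le order_trans by blast
  qed (use s[of n] in simp)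
  have U_op: "open (U n)" for n
    unfolding U_def by (intro open_Collect_less continuous_intros)
  have le: "\<bar>nu (\<phi> n)\<bar> \<le> lam (U n - K)" for n
  proof (rule nu_cutoff_le[OF K(1,2), where L="L n" and r="s n" and \<Lambda>="1 / s n"])
    show "compact (L n)" unfolding L_def using False K(2) s[of n] by (intro compact_infdist_le) auto
    show "L n \<subseteq> U n" using s[of n] by (auto simp: L_def U_def)
    show "U n \<subseteq> \<Omega>" using d(2) s3[of n] by (force simp: U_def)
    show "\<phi> n x = 0" if "x \<notin> L n" for x
      using that s[of n] by (simp add: \<phi>_def L_def le_divide_eq)
    show "0 \<le> \<phi> n x" "\<phi> n x \<le> 1" for x by (auto simp: \<phi>_def)
    show "\<phi> n y = 1" if "x \<in> K" "y \<in> ball x (s n)" for x y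
    proof -
      have "infdist y K \<le> s n" using infdist_le[OF that(1), of y] that(2) by (simp add: dist_commute)
      then have "infdist y K / s n \<le> 1" using s[of n] by (simp add: divide_le_eq)
      then show ?thesis by (simp add: \<phi>_def)
    qed
  qed (use s U_op Lip in auto)
  have "(\<lambda>n. lam (U n - K)) \<longlonglongrightarrow> 0"
  proof -
    have "(\<Inter>n. U n - K) = {}"
    proof -
      have "x \<in> K" if "\<And>n. x \<in> U n" for x
      proof -
        have "(\<lambda>n. 3 * s n) \<longlonglongrightarrow> 3 * 0" by (intro tendsto_intros s0)
        then have "infdist x K \<le> 0"
          using that by (intro LIMSEQ_le_const[where X="\<lambda>n. 3 * s n"]) (auto simp: U_def intro: less_imp_le)
        then have "infdist x K = 0" using infdist_nonneg[of x K] by linarith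
        then show ?thesis using in_closed_iff_infdist_zero[of K x] compact_imp_closed[OF K(2)] False by simp
      qed
      then show ?thesis by blast
    qed
    then have "measure M (\<Inter>n. U n - K) = 0" "measure N (\<Inter>n. U n - K) = 0" by (simp_all only: measure_empty)
    moreover have dec: "decseq (\<lambda>n. U n - K)"
    proof (rule antimonoI)
      fix m n :: nat assume "m \<le> n"
      from sdec[OF this] show "U n - K \<subseteq> U m - K" by (auto simp: U_def)
    qed
    moreover have bor: "U n - K \<in> sets borel" for n using U_op K(2) by (auto intro: borel_compact)
    ultimately have "(\<lambda>n. measure M (U n - K)) \<longlonglongrightarrow> 0" "(\<lambda>n. measure N (U n - K)) \<longlonglongrightarrow> 0"
      using M.finite_Lim_measure_decseq[OF _ dec] N.finite_Lim_measure_decseq[OF _ dec]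
      by (simp_all only: sets_M sets_N image_subset_iff bor ball_UNIV simp_thms)
    from tendsto_add[OF this] show ?thesis by (simp add: lam_def)
  qed
  then have nu0: "(\<lambda>n. nu (\<phi> n)) \<longlonglongrightarrow> 0"
    using le by (intro Lim_null_comparison[of "\<lambda>n. nu (\<phi> n)"]) auto
  have meas: "\<phi> n \<in> borel_measurable borel" for n
    using lipschitz_on_continuous_on[OF Lip] by (rule borel_measurable_continuous_onI)
  have Kb: "K \<in> sets borel" using K(2) by (rule borel_compact)
  have \<phi>lim: "(\<lambda>n. \<phi> n x) \<longlonglongrightarrow> indicator K x" for x
  proof (cases "x \<in> K")
    case True
    then show ?thesis by (simp add: \<phi>_def)
  next
    case False
    then have pos: "infdist x K > 0"
      using infdist_pos_not_in_closed[OF compact_imp_closed[OF K(2)]] \<open>K \<noteq> {}\<close> by blast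
    have "eventually (\<lambda>n. s n < infdist x K / 2) sequentially"
      using s0 pos by (intro order_tendstoD) auto
    then have "eventually (\<lambda>n. \<phi> n x = indicator K x) sequentially"
    proof eventually_elim
      case (elim n)
      then have "2 \<le> infdist x K / s n" using s[of n] by (simp add: le_divide_eq)
      then show ?case using False by (simp add: \<phi>_def)
    qed
    then show ?thesis by (rule tendsto_eventually)
  qed
  have "(\<lambda>n. integral\<^sup>L M (\<phi> n)) \<longlonglongrightarrow> (\<integral>x. indicator K x \<partial>M)"
    using meas Kb \<phi>lim by (intro integral_dominated_convergence[where w="\<lambda>_. 1"]) (auto simp: \<phi>_def)
  moreover have "(\<lambda>n. integral\<^sup>L N (\<phi> n)) \<longlonglongrightarrow> (\<integral>x. indicator K x \<partial>N)"
    using meas Kb \<phi>lim by (intro integral_dominated_convergence[where w="\<lambda>_. 1"]) (auto simp: \<phi>_def)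
  ultimately have "(\<lambda>n. nu (\<phi> n)) \<longlonglongrightarrow> measure M K - measure N K"
    unfolding nu_def using Kb by (simp add: tendsto_diff)
  from LIMSEQ_unique[OF this nu0] show ?thesis by simp
qed simp

end

subsection \<open>Hausdorff measure\<close>

lemma hausdorff_premeasure_mono:
  "A \<subseteq> B \<Longrightarrow> hausdorff_premeasure k r A \<le> hausdorff_premeasure k r B"
  unfolding hausdorff_premeasure_def by (rule INF_superset_mono) auto

text \<open>The usual argument for outer measures: nearly optimal covers with errors
  \<open>\<epsilon> * (1 / 2) ^ Suc n\<close> are merged along a pairing of the indices. Finiteness
  of the sum makes nearly optimal covers available.\<close>

lemma hausdorff_premeasure_UN_le:
  fixes B :: "nat \<Rightarrow> 'a::metric_space set"
  shows "hausdorff_premeasure k r (\<Union>n. B n) \<le> (\<Sum>n. hausdorff_premeasure k r (B n))"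
proof (cases "(\<Sum>n. hausdorff_premeasure k r (B n)) < top")
  case fin: True
  define g :: "'a set \<Rightarrow> ennreal" where
    "g C = (if C = {} then 0 else ennreal (unit_ball_vol (real k) * (diameter C / 2) ^ k))" for C
  show ?thesis
  proof (rule ennreal_le_epsilon)
    fix \<epsilon> :: real assume \<epsilon>: "\<epsilon> > 0"
    have "\<exists>C. B n \<subseteq> (\<Union>m. C m) \<and> (\<forall>m. bounded (C m) \<and> diameter (C m) \<le> r) \<and>
        (\<Sum>m. g (C m)) \<le> hausdorff_premeasure k r (B n) + ennreal (\<epsilon> * (1 / 2) ^ Suc n)" for n
    proof -
      have "hausdorff_premeasure k r (B n) \<le> (\<Sum>n. hausdorff_premeasure k r (B n))"
        using sum_le_suminf[of "\<lambda>n. hausdorff_premeasure k r (B n)" "{n}"] by simp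
      with fin have "hausdorff_premeasure k r (B n) < top" by (rule order_le_less_trans[rotated])
      then have "hausdorff_premeasure k r (B n) < hausdorff_premeasure k r (B n) + ennreal (\<epsilon> * (1 / 2) ^ Suc n)"
        using \<epsilon> by (simp add: ennreal_add_left_cancel_less[of _ 0, simplified])
      then obtain C where "C \<in> {C. B n \<subseteq> (\<Union>m. C m) \<and> (\<forall>m. bounded (C m) \<and> diameter (C m) \<le> r)}"
        "(\<Sum>m. g (C m)) < hausdorff_premeasure k r (B n) + ennreal (\<epsilon> * (1 / 2) ^ Suc n)"
        unfolding hausdorff_premeasure_def[of k r "B n"] g_def INF_less_iff by blast
      then show ?thesis by (intro exI[of _ C]) (auto intro: less_imp_le)
    qed
    then obtain C where C: "\<And>n. B n \<subseteq> (\<Union>m. C n m)" "\<And>n m. bounded (C n m) \<and> diameter (C n m) \<le> r"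
      and sumC: "\<And>n. (\<Sum>m. g (C n m)) \<le> hausdorff_premeasure k r (B n) + ennreal (\<epsilon> * (1 / 2) ^ Suc n)"
      by metis
    define D where "D i = (case prod_decode i of (n, m) \<Rightarrow> C n m)" for i
    have "(\<Union>n. B n) \<subseteq> (\<Union>i. D i)"
    proof
      fix x assume "x \<in> (\<Union>n. B n)"
      then obtain n m where "x \<in> C n m" using C(1) by blast
      then have "x \<in> D (prod_encode (n, m))" by (simp add: D_def)
      then show "x \<in> (\<Union>i. D i)" by blast
    qed
    moreover have "bounded (D i) \<and> diameter (D i) \<le> r" for i
      using C(2) by (simp add: D_def split: prod.split)
    ultimately have "hausdorff_premeasure k r (\<Union>n. B n) \<le> (\<Sum>i. g (D i))"
      unfolding hausdorff_premeasure_def g_def by (intro INF_lower) auto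
    also have "\<dots> = (\<Sum>n. \<Sum>m. g (C n m))"
      using suminf_ennreal_2dimen[of "\<lambda>n. \<Sum>m. g (C n m)" "\<lambda>(n, m). g (C n m)"]
      by (simp add: D_def case_prod_beta)
    also have "\<dots> \<le> (\<Sum>n. hausdorff_premeasure k r (B n) + ennreal (\<epsilon> * (1 / 2) ^ Suc n))"
      by (intro suminf_le sumC) auto
    also have "\<dots> = (\<Sum>n. hausdorff_premeasure k r (B n)) + (\<Sum>n. ennreal (\<epsilon> * (1 / 2) ^ Suc n))"
      by (intro suminf_add[symmetric]) auto
    also have "(\<Sum>n. ennreal (\<epsilon> * (1 / 2) ^ Suc n)) = ennreal (\<epsilon> * 1)"
      using \<epsilon> by (intro suminf_ennreal_eq sums_mult power_half_series) auto
    finally show "hausdorff_premeasure k r (\<Union>n. B n) \<le> (\<Sum>n. hausdorff_premeasure k r (B n)) + ennreal \<epsilon>"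
      by simp
  qed
next
  case False
  then show ?thesis by (simp add: less_top[symmetric])
qed

lemma hausdorff_measure_mono:
  "A \<subseteq> B \<Longrightarrow> hausdorff_measure k A \<le> hausdorff_measure k B"
  unfolding hausdorff_measure_def by (intro SUP_mono' hausdorff_premeasure_mono)

lemma hausdorff_premeasure_le_measure:
  "r > 0 \<Longrightarrow> hausdorff_premeasure k r B \<le> hausdorff_measure k B"
  unfolding hausdorff_measure_def by (intro SUP_upper) auto

lemma hausdorff_measure_UN_le:
  fixes B :: "nat \<Rightarrow> 'a::metric_space set"
  shows "hausdorff_measure k (\<Union>n. B n) \<le> (\<Sum>n. hausdorff_measure k (B n))"
  unfolding hausdorff_measure_def[of k "\<Union>n. B n"]
proof (rule SUP_least)
  fix r :: real assume "r \<in> {0<..}"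
  then have "(\<Sum>n. hausdorff_premeasure k r (B n)) \<le> (\<Sum>n. hausdorff_measure k (B n))"
    by (intro suminf_le hausdorff_premeasure_le_measure) auto
  with hausdorff_premeasure_UN_le show "hausdorff_premeasure k r (\<Union>n. B n) \<le> (\<Sum>n. hausdorff_measure k (B n))"
    by (rule order_trans)
qed

text \<open>Covering sets may have diameter 0, while the open balls replacing them need a radius
  strictly above the diameter; right continuity of the power keeps the cost of enlarging
  small.\<close>

lemma power_increase_small:
  fixes d \<epsilon> s :: real
  assumes "\<epsilon> > 0" "s > 0"
  shows "\<exists>\<rho>. d < \<rho> \<and> \<rho> < d + s \<and> \<rho> ^ k < d ^ k + \<epsilon>"
proof -
  have "((\<lambda>x. x ^ k) \<longlongrightarrow> d ^ k) (at_right d)"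
    by (intro tendsto_intros)
  then have "eventually (\<lambda>x. x ^ k < d ^ k + \<epsilon>) (at_right d)"
    using assms by (intro order_tendstoD) auto
  moreover have "eventually (\<lambda>x. x < d + s) (at_right d)"
    using assms by (auto simp: eventually_at_right_field intro: exI[of _ "d + s"])
  moreover have "eventually (\<lambda>x. d < x) (at_right d)" by (rule eventually_at_right_less)
  ultimately have "eventually (\<lambda>\<rho>. d < \<rho> \<and> \<rho> < d + s \<and> \<rho> ^ k < d ^ k + \<epsilon>) (at_right d)"
    by eventually_elim auto
  then show ?thesis using eventually_happens' trivial_limit_at_right_real by blast
qed

text \<open>A covering set that meets \<open>K\<close> lies in a ball centred at a common point with
  radius just above its diameter; sets that miss \<open>K\<close> are dropped, and compactness
  leaves finitely many balls.\<close>

lemma null_by_balls_compact: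
  fixes K :: "'a::euclidean_space set"
  assumes K: "compact K" and null: "hausdorff_measure (DIM('a) - 1) K = 0"
  shows "null_by_balls K"
  unfolding null_by_balls_def
proof (intro allI impI)
  fix \<eta> r :: real assume \<eta>: "\<eta> > 0" and r: "r > 0"
  define k where "k = DIM('a) - 1"
  \<comment> \<open>The premeasure weighs a set by \<open>\<omega>\<close> times the k-th power of
    its diameter, while the sum in \<open>null_by_balls\<close> carries no constant.\<close>
  define \<omega> where "\<omega> = unit_ball_vol (real k) / 2 ^ k"
  have \<omega>: "\<omega> > 0" by (simp add: \<omega>_def)
  define g :: "'a set \<Rightarrow> ennreal" where
    "g C = (if C = {} then 0 else ennreal (unit_ball_vol (real k) * (diameter C / 2) ^ k))" for C
  \<comment> \<open>Half of \<open>r\<close> and half of \<open>\<eta>\<close> are reserved for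
    enlarging the diameters to radii.\<close>
  have "hausdorff_premeasure k (r / 2) K = 0"
    using hausdorff_premeasure_le_measure[of "r / 2" k K] null r by (simp add: k_def)
  then have "hausdorff_premeasure k (r / 2) K < ennreal (\<omega> * (\<eta> / 2))"
    using \<eta> \<omega> by simp
  then obtain C :: "nat \<Rightarrow> 'a set" where C: "K \<subseteq> (\<Union>n. C n)" "\<And>n. bounded (C n)" "\<And>n. diameter (C n) \<le> r / 2"
    and sumC: "(\<Sum>n. g (C n)) < ennreal (\<omega> * (\<eta> / 2))"
    unfolding hausdorff_premeasure_def g_def INF_less_iff by blast
  define J where "J = {n. C n \<inter> K \<noteq> {}}"
  have "\<exists>x. x \<in> C n \<inter> K" if "n \<in> J" for n using that by (auto simp: J_def)
  then obtain a where a: "\<And>n. n \<in> J \<Longrightarrow> a n \<in> C n \<inter> K" by metis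
  have "\<exists>\<rho>. diameter (C n) < \<rho> \<and> \<rho> < diameter (C n) + r / 2 \<and>
      \<rho> ^ k < diameter (C n) ^ k + \<eta> / 2 * (1 / 2) ^ Suc n" for n
    using \<eta> r by (intro power_increase_small) auto
  then obtain \<rho> where \<rho>: "\<And>n. diameter (C n) < \<rho> n" "\<And>n. \<rho> n < diameter (C n) + r / 2"
    "\<And>n. \<rho> n ^ k < diameter (C n) ^ k + \<eta> / 2 * (1 / 2) ^ Suc n" by metis
  have "K \<subseteq> (\<Union>n\<in>J. ball (a n) (\<rho> n))"
  proof
    fix x assume x: "x \<in> K"
    then obtain n where n: "x \<in> C n" using C(1) by blast
    then have J: "n \<in> J" using x by (auto simp: J_def)
    have "dist (a n) x \<le> diameter (C n)"
      using a[OF J] n by (intro diameter_bounded_bound C(2)) auto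
    then have "x \<in> ball (a n) (\<rho> n)" using \<rho>(1)[of n] by simp
    then show "x \<in> (\<Union>n\<in>J. ball (a n) (\<rho> n))" using J by blast
  qed
  with K obtain I where I: "I \<subseteq> J" "finite I" "K \<subseteq> (\<Union>n\<in>I. ball (a n) (\<rho> n))"
    using compactE_image[of K J "\<lambda>n. ball (a n) (\<rho> n)"] by auto
  have d0: "0 \<le> diameter (C n)" for n by (rule diameter_ge_0[OF C(2)])
  have "(\<Sum>n\<in>I. ennreal (\<omega> * diameter (C n) ^ k)) = (\<Sum>n\<in>I. g (C n))"
    using a I(1) by (intro sum.cong) (auto simp: g_def \<omega>_def power_divide)
  also have "\<dots> \<le> (\<Sum>n. g (C n))" using I(2) by (intro sum_le_suminf) auto
  also note sumC
  finally have "(\<Sum>n\<in>I. \<omega> * diameter (C n) ^ k) < \<omega> * (\<eta> / 2)"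
    using \<omega> \<eta> d0 by (simp add: sum_ennreal ennreal_less_iff sum_nonneg)
  then have 1: "(\<Sum>n\<in>I. diameter (C n) ^ k) < \<eta> / 2"
    using \<omega> by (simp flip: sum_distrib_left)
  have "(\<Sum>n\<in>I. (1 / 2 :: real) ^ Suc n) \<le> (\<Sum>n. (1 / 2) ^ Suc n)"
    using I(2) sums_summable[OF power_half_series] by (intro sum_le_suminf) auto
  also have "\<dots> = 1" using power_half_series by (rule sums_unique[symmetric])
  finally have 2: "\<eta> / 2 * (\<Sum>n\<in>I. (1 / 2 :: real) ^ Suc n) \<le> \<eta> / 2"
    using mult_left_mono[of "\<Sum>n\<in>I. (1 / 2 :: real) ^ Suc n" 1 "\<eta> / 2"] \<eta> by simp
  have "(\<Sum>n\<in>I. \<rho> n ^ k) \<le> (\<Sum>n\<in>I. diameter (C n) ^ k + \<eta> / 2 * (1 / 2) ^ Suc n)"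
    using \<rho>(3) by (intro sum_mono less_imp_le)
  also have "\<dots> = (\<Sum>n\<in>I. diameter (C n) ^ k) + \<eta> / 2 * (\<Sum>n\<in>I. (1 / 2) ^ Suc n)"
    by (simp only: sum.distrib sum_distrib_left)
  also have "\<dots> < \<eta>" using 1 2 by linarith
  finally have "(\<Sum>n\<in>I. \<rho> n ^ k) < \<eta>" .
  moreover have "a n \<in> K \<and> 0 < \<rho> n \<and> \<rho> n < r" if "n \<in> I" for n
    using that a I(1) \<rho>(1,2)[of n] C(3)[of n] d0[of n] by auto
  ultimately show "\<exists>(I :: nat set) a \<rho>. finite I \<and> K \<subseteq> (\<Union>i\<in>I. ball (a i) (\<rho> i)) \<and>
      (\<forall>i\<in>I. a i \<in> K \<and> 0 < \<rho> i \<and> \<rho> i < r) \<and> (\<Sum>i\<in>I. \<rho> i ^ (DIM('a) - 1)) < \<eta>"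
    using I(2,3) unfolding k_def by blast
qed

(* No sigma-finiteness of the Hausdorff measure is needed: the limsup of a sequence of bad sets would be
   a null set of positive measure. *)
lemma finite_measure_hausdorff_small:
  fixes M :: "'a::metric_space measure"
  assumes fin: "finite_measure M" and sets_M: "sets M = sets borel"
    and ac: "\<And>B. B \<in> sets borel \<Longrightarrow> B \<subseteq> \<Omega> \<Longrightarrow> hausdorff_measure k B = 0 \<Longrightarrow> emeasure M B = 0"
    and \<epsilon>: "\<epsilon> > 0"
  shows "\<exists>\<delta>>0. \<forall>B. B \<in> sets borel \<and> B \<subseteq> \<Omega> \<and> hausdorff_measure k B < ennreal \<delta> \<longrightarrow> measure M B < \<epsilon>"
proof (rule ccontr)
  assume "\<not> ?thesis"
  \<comment> \<open>Summable thresholds, as in the Borel-Cantelli lemma: the tail unions then have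
    Hausdorff measure at most \<open>(1 / 2) ^ n * 2\<close>.\<close>
  then have "\<exists>B. B \<in> sets borel \<and> B \<subseteq> \<Omega> \<and> hausdorff_measure k B < ennreal ((1 / 2) ^ n) \<and> \<not> measure M B < \<epsilon>" for n :: nat
    by (metis half_gt_zero_iff zero_less_one zero_less_power)
  then obtain B where B: "\<And>n. B n \<in> sets borel" "\<And>n. B n \<subseteq> \<Omega>"
    "\<And>n. hausdorff_measure k (B n) < ennreal ((1 / 2) ^ n)" "\<And>n. \<epsilon> \<le> measure M (B n)"
    by (metis not_le)
  define A where "A n = (\<Union>j. B (j + n))" for n
  have A: "A n \<in> sets borel" for n unfolding A_def using B(1) by auto
  have dec: "decseq A"
  proof (rule decseq_SucI)
    show "A (Suc n) \<subseteq> A n" for n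
    proof
      fix x assume "x \<in> A (Suc n)"
      then obtain j where "x \<in> B (Suc j + n)" by (auto simp: A_def)
      then show "x \<in> A n" unfolding A_def by blast
    qed
  qed
  have "A 0 \<subseteq> \<Omega>" using B(2) by (auto simp: A_def)
  then have D: "(\<Inter>n. A n) \<in> sets borel" "(\<Inter>n. A n) \<subseteq> \<Omega>"
    using A by auto
  have "hausdorff_measure k (\<Inter>n. A n) \<le> ennreal ((1 / 2) ^ n * 2)" for n
  proof -
    have "hausdorff_measure k (\<Inter>n. A n) \<le> hausdorff_measure k (A n)"
      by (intro hausdorff_measure_mono) auto
    also have "\<dots> \<le> (\<Sum>j. hausdorff_measure k (B (j + n)))"
      unfolding A_def by (rule hausdorff_measure_UN_le)
    also have "\<dots> \<le> (\<Sum>j. ennreal ((1 / 2) ^ (j + n)))"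
      using B(3) by (intro suminf_le less_imp_le) auto
    also have "\<dots> = ennreal ((1 / 2) ^ n * 2)"
      using sums_mult[OF geometric_sums[of "1 / 2 :: real"], of "(1 / 2) ^ n"]
      by (intro suminf_ennreal_eq) (auto simp: power_add mult.commute)
    finally show ?thesis .
  qed
  moreover have "(\<lambda>n. ennreal ((1 / 2) ^ n * 2)) \<longlonglongrightarrow> ennreal (0 * 2)"
    by (intro tendsto_ennrealI tendsto_intros LIMSEQ_power_zero) auto
  ultimately have "hausdorff_measure k (\<Inter>n. A n) \<le> ennreal (0 * 2)"
    by (intro LIMSEQ_le_const[where X="\<lambda>n. ennreal ((1 / 2) ^ n * 2)"]) auto
  then have "emeasure M (\<Inter>n. A n) = 0" using D by (intro ac) auto
  moreover have "(\<lambda>n. measure M (A n)) \<longlonglongrightarrow> measure M (\<Inter>n. A n)"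
    using A dec by (intro finite_measure.finite_Lim_measure_decseq[OF fin]) (auto simp: sets_M)
  moreover have "\<epsilon> \<le> measure M (A n)" for n
  proof -
    have "B (0 + n) \<subseteq> A n" unfolding A_def by blast
    then have "B n \<subseteq> A n" by simp
    then have "measure M (B n) \<le> measure M (A n)"
      using A by (intro finite_measure.finite_measure_mono[OF fin]) (auto simp: sets_M)
    then show ?thesis using B(4)[of n] by simp
  qed
  ultimately have "\<epsilon> \<le> 0"
    by (intro LIMSEQ_le_const[where X="\<lambda>n. measure M (A n)"]) (auto simp: measure_def)
  then show False using \<epsilon> by simp
qed

subsection \<open>Absolute continuity of the gradient\<close>

lemma total_variation_le_sum_components:
  "total_variation \<mu> B \<le> (\<Sum>i\<in>Basis. total_variation (\<lambda>A. \<mu> A \<bullet> i) B)"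
  unfolding total_variation_def[of \<mu>]
proof (rule SUP_least)
  fix A :: "nat \<Rightarrow> 'a set"
  assume A: "A \<in> {A. range A \<subseteq> sets borel \<and> disjoint_family A \<and> \<Union> (range A) = B}"
  have "(\<Sum>n. ennreal (norm (\<mu> (A n)))) \<le> (\<Sum>n. \<Sum>i\<in>Basis. ennreal \<bar>\<mu> (A n) \<bullet> i\<bar>)"
    by (intro suminf_le) (auto simp: sum_ennreal intro: ennreal_leI norm_le_l1)
  also have "\<dots> = (\<Sum>i\<in>Basis. \<Sum>n. ennreal (norm (\<mu> (A n) \<bullet> i)))"
    by (subst suminf_sum) auto
  also have "\<dots> \<le> (\<Sum>i\<in>Basis. total_variation (\<lambda>A. \<mu> A \<bullet> i) B)"
    unfolding total_variation_def using A by (intro sum_mono SUP_upper)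
  finally show "(\<Sum>n. ennreal (norm (\<mu> (A n)))) \<le> (\<Sum>i\<in>Basis. total_variation (\<lambda>A. \<mu> A \<bullet> i) B)" .
qed

lemma bump_algebra_test_function:
  assumes "bump_algebra f" "compact L" "L \<subseteq> \<Omega>" "\<And>x. x \<notin> L \<Longrightarrow> f x = 0"
  shows "test_function \<Omega> f"
proof -
  have "closure {x. f x \<noteq> 0} \<subseteq> L"
    using assms(2,4) by (intro closure_minimal compact_imp_closed) auto
  moreover from this have "compact (closure {x. f x \<noteq> 0})"
    using assms(2) compact_Int_closed[of L "closure {x. f x \<noteq> 0}"] by (simp add: Int_absorb1)
  ultimately show ?thesis
    unfolding test_function_def using bump_algebra_smooth[OF assms(1)] assms(3) by blast
qed

lemma emeasure_eq_0_if_compact: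
  fixes M :: "'a::{second_countable_topology, complete_space} measure"
  assumes "finite_measure M" "sets M = sets borel" "B \<in> sets borel"
    and "\<And>K. compact K \<Longrightarrow> K \<subseteq> B \<Longrightarrow> emeasure M K = 0"
  shows "emeasure M B = 0"
proof -
  have "emeasure M B = (SUP K\<in>{K. K \<subseteq> B \<and> compact K}. emeasure M K)"
    using assms(1-3) by (intro inner_regular) (auto simp: finite_measure.emeasure_finite)
  also have "\<dots> \<le> 0" using assms(4) by (intro SUP_least) auto
  finally show ?thesis by simp
qed

lemma gradient_component_small:
  fixes \<Omega> :: "'a::euclidean_space set" and u :: "'a \<Rightarrow> real"
  assumes \<Omega>: "open \<Omega>" and u: "set_integrable lebesgue \<Omega> u"
    and \<mu>: "is_distributional_gradient \<Omega> u \<mu>" and i: "i \<in> Basis" and \<epsilon>: "\<epsilon> > 0"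
  shows "\<exists>\<delta>>0. \<forall>B. B \<in> sets borel \<and> B \<subseteq> \<Omega> \<and> hausdorff_measure (DIM('a) - 1) B < ennreal \<delta> \<longrightarrow>
    total_variation (\<lambda>A. \<mu> A \<bullet> i) B < ennreal \<epsilon>"
proof -
  define \<nu> where "\<nu> A = \<mu> A \<bullet> i" for A
  have \<nu>: "vector_measure_on \<Omega> \<nu>"
    unfolding \<nu>_def[abs_def] using \<mu> by (auto simp: is_distributional_gradient_def intro: vector_measure_on_component)
  have \<nu>': "vector_measure_on \<Omega> (\<lambda>A. - \<nu> A)" by (rule vector_measure_on_uminus[OF \<nu>])
  have bor: "\<Omega> \<in> sets borel" using \<Omega> by simp
  have S: "A \<inter> \<Omega> \<in> sets (restrict_space borel \<Omega>)" if "A \<in> sets borel" for A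
    using that bor by (auto simp: sets_restrict_space_iff)
  obtain P where P: "P \<in> sets (restrict_space borel \<Omega>)"
    and pos': "\<And>A. A \<in> sets (restrict_space borel \<Omega>) \<Longrightarrow> \<nu> (A \<inter> P) \<ge> 0"
    and neg': "\<And>A. A \<in> sets (restrict_space borel \<Omega>) \<Longrightarrow> \<nu> (A - P) \<le> 0"
    using Hahn_decomposition[OF \<nu>] by blast
  have Pb: "P \<in> sets borel" "P \<subseteq> \<Omega>" using P bor by (auto simp: sets_restrict_space_iff)
  have Qb: "\<Omega> - P \<in> sets borel" "\<Omega> - P \<subseteq> \<Omega>" using Pb bor by auto
  have pos: "\<nu> (A \<inter> P) \<ge> 0" if "A \<in> sets borel" for A
  proof -
    have "(A \<inter> \<Omega>) \<inter> P = A \<inter> P" using Pb by auto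
    then show ?thesis using pos'[OF S[OF that]] by simp
  qed
  have neg: "\<nu> (A \<inter> (\<Omega> - P)) \<le> 0" if "A \<in> sets borel" for A
  proof -
    have "(A \<inter> \<Omega>) - P = A \<inter> (\<Omega> - P)" by auto
    then show ?thesis using neg'[OF S[OF that]] by simp
  qed
  have neg2: "0 \<le> - \<nu> (A \<inter> (\<Omega> - P))" if "A \<in> sets borel" for A using neg[OF that] by simp
  define M where "M = part_measure \<Omega> \<nu> P"
  define N where "N = part_measure \<Omega> (\<lambda>A. - \<nu> A) (\<Omega> - P)"
  have emM: "emeasure M A = ennreal (\<nu> (A \<inter> P))" if "A \<in> sets borel" for A
    unfolding M_def by (rule emeasure_part_measure[OF \<nu> bor Pb]) (fact pos that)+
  have emN: "emeasure N A = ennreal (- \<nu> (A \<inter> (\<Omega> - P)))" if "A \<in> sets borel" for A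
    unfolding N_def by (rule emeasure_part_measure[OF \<nu>' bor Qb]) (fact neg2 that)+
  have sM: "sets M = sets borel" and sN: "sets N = sets borel" by (simp_all add: M_def N_def)
  have fM: "finite_measure M" unfolding M_def by (rule finite_part_measure[OF \<nu> bor Pb]) (fact pos)
  have fN: "finite_measure N" unfolding N_def by (rule finite_part_measure[OF \<nu>' bor Qb]) (fact neg2)
  have si: "signed_integral \<Omega> \<nu> f = integral\<^sup>L M f - integral\<^sup>L N f" if "\<And>x. x \<notin> \<Omega> \<Longrightarrow> f x = 0" for f
    unfolding M_def N_def by (rule signed_integral_eq[OF \<nu> bor Pb]) (fact pos neg that)+
  have tv: "total_variation \<nu> A = emeasure M A + emeasure N A" if A: "A \<in> sets borel" "A \<subseteq> \<Omega>" for A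
    unfolding emM[OF A(1)] emN[OF A(1)]
    by (rule total_variation_Hahn[OF \<nu> bor Pb]) (fact pos neg A)+

  \<comment> \<open>The definition of the gradient integrates over \<open>lebesgue\<close>, the
    locale over \<open>lborel\<close>; a Borel function equal to the extension of \<open>u\<close>
    by 0 almost everywhere mediates between them.\<close>
  have u': "integrable lebesgue (\<lambda>x. indicator \<Omega> x * u x)" using u by (simp add: set_integrable_def)
  then obtain w where w: "w \<in> borel_measurable lborel" and uw: "AE x in lborel. indicator \<Omega> x * u x = w x"
    using completion_ex_borel_measurable_real[of "\<lambda>x. indicator \<Omega> x * u x" lborel] by auto
  have uw': "AE x in lebesgue. indicator \<Omega> x * u x = w x" by (rule AE_completion[OF uw])
  have [measurable]: "w \<in> borel_measurable lebesgue" using w by (rule measurable_completion)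
  have "integrable lebesgue w"
    using u' uw' by (subst integrable_cong_AE[symmetric, of "\<lambda>x. indicator \<Omega> x * u x"]) auto
  then have wi: "integrable lborel w" using integrable_completion[OF w] by simp

  interpret line_derivative_measure w i \<Omega> M N
  proof (rule line_derivative_measure.intro)
    show "integrable lborel w" "norm i = 1" "open \<Omega>" "sets M = sets borel" "sets N = sets borel"
      "finite_measure M" "finite_measure N" by (fact wi norm_Basis[OF i] \<Omega> sM sN fM fN)+
    fix f :: "'a \<Rightarrow> real" and L
    assume f: "bump_algebra f" "compact L" "L \<subseteq> \<Omega>" "\<And>x. x \<notin> L \<Longrightarrow> f x = 0"
    have pd: "partial_deriv i f \<in> borel_measurable borel"
      by (intro borel_measurable_continuous_onI bump_algebra_continuous bump_algebra_partial_deriv f(1))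
    then have [measurable]: "partial_deriv i f \<in> borel_measurable lebesgue"
      by (intro measurable_completion) simp
    have "(LINT x|lborel. w x * partial_deriv i f x) = (LINT x|lebesgue. w x * partial_deriv i f x)"
      using w pd by (intro integral_completion[symmetric]) auto
    also have "\<dots> = (LINT x|lebesgue. (indicator \<Omega> x * u x) * partial_deriv i f x)"
    proof (rule integral_cong_AE)
      show "(\<lambda>x. indicator \<Omega> x * u x * partial_deriv i f x) \<in> borel_measurable lebesgue"
        by (rule borel_measurable_times[OF borel_measurable_integrable[OF u']]) measurable
      show "AE x in lebesgue. w x * partial_deriv i f x = indicator \<Omega> x * u x * partial_deriv i f x"
        using uw' by eventually_elim simp
    qed measurable
    also have "\<dots> = (LINT x:\<Omega>|lebesgue. u x * partial_deriv i f x)"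
      by (simp add: set_lebesgue_integral_def mult.assoc)
    also have "\<dots> = - signed_integral \<Omega> \<nu> f"
      using \<mu> i bump_algebra_test_function[OF f] unfolding is_distributional_gradient_def \<nu>_def[abs_def] by blast
    also have "signed_integral \<Omega> \<nu> f = integral\<^sup>L M f - integral\<^sup>L N f"
      using f(3,4) by (intro si) blast
    finally show "(LINT x|lborel. w x * partial_deriv i f x) = - (integral\<^sup>L M f - integral\<^sup>L N f)" .
  qed

  have null: "emeasure M B = 0 \<and> emeasure N B = 0"
    if B: "B \<in> sets borel" "B \<subseteq> \<Omega>" "hausdorff_measure (DIM('a) - 1) B = 0" for B
  proof -
    have K: "measure M K = measure N K" if "compact K" "K \<subseteq> B" for K
    proof (rule measure_null_compact_eq)
      have "hausdorff_measure (DIM('a) - 1) K = 0"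
        using hausdorff_measure_mono[OF that(2), of "DIM('a) - 1"] B(3) by simp
      then show "null_by_balls K" by (rule null_by_balls_compact[OF that(1)])
    qed (use that B(2) in auto)
    have \<nu>0: "\<nu> {} = 0" by (rule vector_measure_on_empty[OF \<nu>])
    \<comment> \<open>For null \<open>K\<close> only equality of the two parts is known so far.
      Inside \<open>P\<close> the part \<open>N\<close> vanishes, so equality forces
      \<open>M\<close> to vanish; on \<open>\<Omega> - P\<close> the roles are exchanged.\<close>
    have cM: "emeasure M K = 0" if "compact K" "K \<subseteq> B \<inter> P" for K
    proof -
      have Kb: "K \<in> sets borel" using that(1) by (rule borel_compact)
      have "K \<inter> (\<Omega> - P) = {}" using that(2) by auto
      then have "emeasure N K = 0" using emN[OF Kb] \<nu>0 by simp
      then have "measure M K = 0" using K[OF that(1)] that(2) by (simp add: measure_def)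
      then show ?thesis by (simp add: finite_measure.emeasure_eq_measure[OF fM])
    qed
    have "emeasure M (B \<inter> P) = 0"
      by (rule emeasure_eq_0_if_compact[OF fM sM sets.Int[OF B(1) Pb(1)] cM])
    moreover have "B \<inter> P \<inter> P = B \<inter> P" by blast
    ultimately have 1: "emeasure M B = 0"
      using emM[OF B(1)] emM[OF sets.Int[OF B(1) Pb(1)]] by metis
    have cN: "emeasure N K = 0" if "compact K" "K \<subseteq> B \<inter> (\<Omega> - P)" for K
    proof -
      have Kb: "K \<in> sets borel" using that(1) by (rule borel_compact)
      have "K \<inter> P = {}" using that(2) by auto
      then have "emeasure M K = 0" using emM[OF Kb] \<nu>0 by simp
      then have "measure N K = 0" using K[OF that(1)] that(2) by (simp add: measure_def)
      then show ?thesis by (simp add: finite_measure.emeasure_eq_measure[OF fN])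
    qed
    have "emeasure N (B \<inter> (\<Omega> - P)) = 0"
      by (rule emeasure_eq_0_if_compact[OF fN sN sets.Int[OF B(1) Qb(1)] cN])
    moreover have "B \<inter> (\<Omega> - P) \<inter> (\<Omega> - P) = B \<inter> (\<Omega> - P)" by blast
    ultimately have 2: "emeasure N B = 0"
      using emN[OF B(1)] emN[OF sets.Int[OF B(1) Qb(1)]] by metis
    from 1 2 show ?thesis ..
  qed
  obtain d1 where d1: "d1 > 0" "\<And>B. B \<in> sets borel \<Longrightarrow> B \<subseteq> \<Omega> \<Longrightarrow>
      hausdorff_measure (DIM('a) - 1) B < ennreal d1 \<Longrightarrow> measure M B < \<epsilon> / 2"
    using finite_measure_hausdorff_small[OF fM sM, of \<Omega> "DIM('a) - 1" "\<epsilon> / 2"] null \<epsilon> by auto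
  obtain d2 where d2: "d2 > 0" "\<And>B. B \<in> sets borel \<Longrightarrow> B \<subseteq> \<Omega> \<Longrightarrow>
      hausdorff_measure (DIM('a) - 1) B < ennreal d2 \<Longrightarrow> measure N B < \<epsilon> / 2"
    using finite_measure_hausdorff_small[OF fN sN, of \<Omega> "DIM('a) - 1" "\<epsilon> / 2"] null \<epsilon> by auto
  show ?thesis
  proof (intro exI[of _ "min d1 d2"] conjI allI impI)
    show "min d1 d2 > 0" using d1(1) d2(1) by simp
    fix B
    assume B: "B \<in> sets borel \<and> B \<subseteq> \<Omega> \<and> hausdorff_measure (DIM('a) - 1) B < ennreal (min d1 d2)"
    have "ennreal (min d1 d2) \<le> ennreal d1" "ennreal (min d1 d2) \<le> ennreal d2" by (auto intro: ennreal_leI)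
    then have "hausdorff_measure (DIM('a) - 1) B < ennreal d1" "hausdorff_measure (DIM('a) - 1) B < ennreal d2"
      using B order_less_le_trans by blast+
    then have "measure M B < \<epsilon> / 2" "measure N B < \<epsilon> / 2"
      using B d1(2)[of B] d2(2)[of B] by blast+
    then have "measure M B + measure N B < \<epsilon>" by linarith
    then have "ennreal (measure M B + measure N B) < ennreal \<epsilon>" using \<epsilon> by (intro ennreal_lessI)
    moreover have "total_variation \<nu> B = ennreal (measure M B + measure N B)"
      using tv[of B] B by (simp add: finite_measure.emeasure_eq_measure[OF fM]
          finite_measure.emeasure_eq_measure[OF fN])
    ultimately show "total_variation (\<lambda>A. \<mu> A \<bullet> i) B < ennreal \<epsilon>" by (simp add: \<nu>_def[abs_def])
  qed
qed

theorem corollary1p8: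
  fixes \<Omega> :: "'a::euclidean_space set" and u :: "'a \<Rightarrow> real"
  assumes "DIM('a) \<ge> 2"
    and "open \<Omega>" and "compact (frontier \<Omega>)" and "lipschitz_boundary \<Omega>"
    and "u \<in> BV \<Omega>"
  shows "\<forall>\<epsilon>::real. \<epsilon> > 0 \<longrightarrow> (\<exists>\<delta>::real. \<delta> > 0 \<and>
           (\<forall>B. B \<in> sets borel \<and> B \<subseteq> \<Omega> \<and> hausdorff_measure (DIM('a) - 1) B < ennreal \<delta>
              \<longrightarrow> total_variation (distributional_gradient \<Omega> u) B < ennreal \<epsilon>))"
proof (intro allI impI)
  fix \<epsilon> :: real assume \<epsilon>: "\<epsilon> > 0"
  let ?\<mu> = "distributional_gradient \<Omega> u" and ?H = "hausdorff_measure (DIM('a) - 1) :: 'a set \<Rightarrow> ennreal"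
  \<comment> \<open>Membership in \<open>BV\<close> supplies a witness, so the gradient selected by
    \<open>SOME\<close> really has the defining property.\<close>
  have u: "set_integrable lebesgue \<Omega> u" and \<mu>: "is_distributional_gradient \<Omega> u ?\<mu>"
    using assms(5) someI_ex[of "is_distributional_gradient \<Omega> u"]
    unfolding BV_def distributional_gradient_def by auto
  \<comment> \<open>The factor 2 restores strictness after the summation of weak inequalities over
    the components.\<close>
  define \<epsilon>' where "\<epsilon>' = \<epsilon> / (2 * real DIM('a))"
  have "\<epsilon>' > 0" using \<epsilon> by (simp add: \<epsilon>'_def)
  then have "\<exists>\<delta>>0. \<forall>B. B \<in> sets borel \<and> B \<subseteq> \<Omega> \<and> ?H B < ennreal \<delta> \<longrightarrow>
      total_variation (\<lambda>A. ?\<mu> A \<bullet> i) B < ennreal \<epsilon>'" if "i \<in> Basis" for i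
    by (rule gradient_component_small[OF assms(2) u \<mu> that])
  then obtain d where d: "\<And>i. i \<in> Basis \<Longrightarrow> d i > 0"
    "\<And>i B. i \<in> Basis \<Longrightarrow> B \<in> sets borel \<Longrightarrow> B \<subseteq> \<Omega> \<Longrightarrow> ?H B < ennreal (d i) \<Longrightarrow>
      total_variation (\<lambda>A. ?\<mu> A \<bullet> i) B < ennreal \<epsilon>'" by metis
  show "\<exists>\<delta>>0. \<forall>B. B \<in> sets borel \<and> B \<subseteq> \<Omega> \<and> ?H B < ennreal \<delta> \<longrightarrow> total_variation ?\<mu> B < ennreal \<epsilon>"
  proof (intro exI[of _ "Min (d ` Basis)"] conjI allI impI)
    show "Min (d ` Basis) > 0" using d(1) by simp
    fix B assume B: "B \<in> sets borel \<and> B \<subseteq> \<Omega> \<and> ?H B < ennreal (Min (d ` Basis))"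
    have "total_variation (\<lambda>A. ?\<mu> A \<bullet> i) B < ennreal \<epsilon>'" if i: "i \<in> Basis" for i
    proof -
      have "ennreal (Min (d ` Basis)) \<le> ennreal (d i)" using i by (intro ennreal_leI) simp
      then show ?thesis using B by (intro d(2) i) (auto elim: order_less_le_trans)
    qed
    then have "(\<Sum>i\<in>Basis. total_variation (\<lambda>A. ?\<mu> A \<bullet> i) B) \<le> (\<Sum>i\<in>(Basis :: 'a set). ennreal \<epsilon>')"
      by (intro sum_mono less_imp_le)
    also have "\<dots> = ennreal (real DIM('a) * \<epsilon>')"
      using \<open>\<epsilon>' > 0\<close> by (subst sum_ennreal) auto
    also have "\<dots> < ennreal \<epsilon>"
      using \<epsilon> by (intro ennreal_lessI) (simp_all add: \<epsilon>'_def)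
    finally show "total_variation ?\<mu> B < ennreal \<epsilon>"
      using total_variation_le_sum_components[of ?\<mu> B] by (rule order_le_less_trans[rotated])
  qed
qed

end
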